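(* Let $\theta=(\Omega,\mathcal{F},\mathbb{P},\{\theta_t\}_{t\in\mathbb{R}})$ be a metric dynamical system and let $(\phi,\Theta)$ be a local semi-flow defined on $(\Omega,\mathcal{F},\mathbb{P})$ taking values in a Polish space $X$. Assume that for every $s\ge0$ there exists a $\mathbb{P}$-null set $N_s$ such that for all $x\in X$ and all $\omega\notin N_s$ $$\Theta(s,x,\omega)=\Theta(0,x,\theta_s\omega)+s$$ and $$\phi_{s,s+t}(x,\omega)=\phi_{0,t}(x,\theta_s\omega)\quad\text{for all }t\in[0,\Theta(s,x,\omega)-s).$$ Then there exist $\tau:X\times\Omega\to(0,\infty]$ and $\varphi:D\to X$, where $D=\{(t,x,\omega)\in[0,\infty)\times X\times\Omega: t<\tau(x,\omega)\}$, such that $(\phi_{0,\cdot},\Theta(0,\cdot))$ and $(\varphi,\tau)$ are indistinguishable and $(\theta,\varphi,\tau)$ is a local random dynamical system (local RDS). If $(\phi,\Theta)$ is a continuous local semi-flow, then $(\theta,\varphi,\tau)$ is a continuous local RDS; if $(\phi,\Theta)$ is a global semi-flow, then $(\theta,\varphi,\tau)$ is a global RDS.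
   Context: A Polish space is a separable completely metrizable topological space, equipped with its Borel $\sigma$-field. Metric dynamical system (MDS): a probability space $(\Omega,\mathcal{F},\mathbb{P})$ with maps $\theta_t:\Omega\to\Omega$, $t\in\mathbb{R}$, such that $\theta_0=\mathrm{id}$, $\theta_{t+s}=\theta_t\circ\theta_s$ for all $s,t\in\mathbb{R}$, $(t,\omega)\mapsto\theta_t\omega$ is measurable, and $\theta_t\mathbb{P}=\mathbb{P}$ for all $t$. Local semi-flow: a local semi-flow $(\phi,\Theta)$ on a Polish space $X$ consists of two measurable maps $\Theta:[0,\infty)\times X\times\Omega\to(0,\infty]$ and $\phi:\{(s,t,x,\omega)\in[0,\infty)^2\times X\times\Omega: s\le t<\Theta(s,x,\omega)\}\to X$ such that for each $\omega\in\Omega$ (suppressed in the notation): (i) $(s,x)\mapsto\Theta(s,x)$ is lower semi-continuous; (ii) for every $x\in X$ and $t$, $s\mapsto\phi_{s,t}(x)$ is right continuous at those $s\in[0,t)$ for which $t<\Theta(s,x)$; (iii) $t\mapsto\phi_{s,t}(x)$ is right continuous on $[s,\Theta(s,x))$ for every $x\in X$, $s\ge0$; (iv) for all $0\le s\le t<u$ and $x\in X$, $u<\Theta(s,x)$ iff both $t<\Theta(s,x)$ and $u<\Theta(t,\phi_{s,t}(x))$, and in this case $\phi_{s,u}(x)=\phi_{t,u}(\phi_{s,t}(x))$; (v) $\phi_{s,s}(x)=x$ for all $x\in X$, $s\ge0$. It is a continuous local semi-flow if in addition $x\mapsto\phi_{s,t}(x)$ is continuous for every $0\le s\le t<\Theta(s,x)$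 (i.e. on $\{x:\Theta(s,x)>t\}$). It is a (global) semi-flow if $\Theta(s,x,\omega)=\infty$ for all $s,x,\omega$. Local RDS: a local RDS $(\theta,\varphi,\tau)$ on a Polish space $X$ consists of an MDS $\theta$ and measurable maps $\tau:X\times\Omega\to(0,\infty]$ and $\varphi:\{(t,x,\omega)\in[0,\infty)\times X\times\Omega:t<\tau(x,\omega)\}\to X$ such that for each $\omega\in\Omega$: (1) $x\mapsto\tau(x,\omega)$ is lower semi-continuous; (2) $t\mapsto\varphi_t(x,\omega)$ is right continuous on $[0,\tau(x,\omega))$ for every $x\in X$; (3) $\tau(\varphi_s(x,\omega),\theta_s\omega)+s=\tau(x,\omega)$ whenever $s<\tau(x,\omega)$; (4) (perfect cocycle property) $\varphi_0(\cdot,\omega)=\mathrm{id}$ and $\varphi_{t+s}(x,\omega)=\varphi_t(\varphi_s(x,\omega),\theta_s\omega)$ for all $s,t\ge0$, $x\in X$ with $t+s<\tau(x,\omega)$. It is a continuous local RDS if in addition, for each $t\ge0$, $x\mapsto\varphi_t(x)$ is continuous on $\{\tau(x)>t\}$. It is a (global) RDS if $\tau(x,\omega)=\infty$ for all $x,\omega$. Indistinguishability of $(\phi_{0,\cdot},\Theta(0,\cdot))$ and $(\varphi,\tau)$ means that the set of $\omega$ for which $\tau(x,\omega)=\Theta(0,x,\omega)$ for all $x\in X$ and $\varphi_t(x,\omega)=\phi_{0,t}(x,\omega)$ for all $x\in X$, $0\le t<\tau(x,\omega)$ has inner $\mathbb{P}$-measure $1$. *)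

theory Defs
  imports "HOL-Probability.Probability"
begin

text \<open>
  Conventions. The probability space \<open>(\<Omega>, F, P)\<close> is a measure \<open>M\<close> with \<open>\<Omega> = space M\<close>; it is not
  assumed complete. Lifetimes in \<open>(0,\<infinity>]\<close> are positive elements of \<^typ>\<open>ereal\<close>. Partially defined
  maps are total functions that are only constrained on their domain: every condition below is
  guarded by the domain, and measurability refers to the trace of the product \<open>\<sigma>\<close>-field on it.
\<close>

definition lower_semicontinuous_on :: "'b::topological_space set \<Rightarrow> ('b \<Rightarrow> ereal) \<Rightarrow> bool" where
  "lower_semicontinuous_on S f \<longleftrightarrow> (\<forall>a. openin (top_of_set S) {x \<in> S. a < f x})"

definition inner_measure :: "'w measure \<Rightarrow> 'w set \<Rightarrow> ennreal" where
  "inner_measure M A = (SUP B \<in> {B \<in> sets M. B \<subseteq> A}. emeasure M B)"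

locale metric_dynamical_system = prob_space M
  for M :: "'w measure" +
  fixes \<theta> :: "real \<Rightarrow> 'w \<Rightarrow> 'w"
  assumes shift_zero: "\<omega> \<in> space M \<Longrightarrow> \<theta> 0 \<omega> = \<omega>"
    and shift_add: "\<omega> \<in> space M \<Longrightarrow> \<theta> (t + s) \<omega> = \<theta> t (\<theta> s \<omega>)"
    and shift_measurable: "(\<lambda>(t, \<omega>). \<theta> t \<omega>) \<in> measurable (borel \<Otimes>\<^sub>M M) M"
    and shift_measure_preserving: "distr M M (\<theta> t) = M"

text \<open>
  In \<open>flow_id\<close> the inequality \<open>s < \<Theta> s x \<omega>\<close> says that \<open>\<phi> s s x \<omega>\<close> is defined, as the requirement
  \<open>\<phi> s s x \<omega> = x\<close> presupposes. In \<open>flow_right_cont_start\<close> and \<open>flow_right_cont_end\<close> the values of \<open>\<phi>\<close>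
  outside its domain are irrelevant: the points of the domain form a right neighbourhood (of the
  starting time \<open>s\<close>, by lower semicontinuity of \<open>\<Theta>\<close>; of the end time \<open>t\<close>, trivially).
\<close>

locale local_semi_flow =
  fixes M :: "'w measure"
    and \<phi> :: "real \<Rightarrow> real \<Rightarrow> 'a::polish_space \<Rightarrow> 'w \<Rightarrow> 'a"
    and \<Theta> :: "real \<Rightarrow> 'a \<Rightarrow> 'w \<Rightarrow> ereal"
  assumes lifetime_pos: "\<lbrakk>\<omega> \<in> space M; 0 \<le> s\<rbrakk> \<Longrightarrow> 0 < \<Theta> s x \<omega>"
    and lifetime_measurable:
      "(\<lambda>(s, x, \<omega>). \<Theta> s x \<omega>) \<in> measurable (restrict_space borel {0..} \<Otimes>\<^sub>M borel \<Otimes>\<^sub>M M) borel"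
    and flow_measurable:
      "(\<lambda>(s, t, x, \<omega>). \<phi> s t x \<omega>) \<in> measurable
        (restrict_space (borel \<Otimes>\<^sub>M borel \<Otimes>\<^sub>M borel \<Otimes>\<^sub>M M)
          {(s, t, x, \<omega>). 0 \<le> s \<and> s \<le> t \<and> ereal t < \<Theta> s x \<omega> \<and> \<omega> \<in> space M}) borel"
    and lifetime_lsc:
      "\<omega> \<in> space M \<Longrightarrow> lower_semicontinuous_on ({0..} \<times> UNIV) (\<lambda>(s, x). \<Theta> s x \<omega>)"
    and flow_right_cont_start:
      "\<lbrakk>\<omega> \<in> space M; 0 \<le> s; s < t; ereal t < \<Theta> s x \<omega>\<rbrakk>
        \<Longrightarrow> continuous (at_right s) (\<lambda>r. \<phi> r t x \<omega>)"
    and flow_right_cont_end: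
      "\<lbrakk>\<omega> \<in> space M; 0 \<le> s; s \<le> t; ereal t < \<Theta> s x \<omega>\<rbrakk>
        \<Longrightarrow> continuous (at_right t) (\<lambda>r. \<phi> s r x \<omega>)"
    and lifetime_iff:
      "\<lbrakk>\<omega> \<in> space M; 0 \<le> s; s \<le> t; t < u\<rbrakk>
        \<Longrightarrow> ereal u < \<Theta> s x \<omega> \<longleftrightarrow> ereal t < \<Theta> s x \<omega> \<and> ereal u < \<Theta> t (\<phi> s t x \<omega>) \<omega>"
    and flow_compose:
      "\<lbrakk>\<omega> \<in> space M; 0 \<le> s; s \<le> t; t < u; ereal u < \<Theta> s x \<omega>\<rbrakk>
        \<Longrightarrow> \<phi> s u x \<omega> = \<phi> t u (\<phi> s t x \<omega>) \<omega>"
    and flow_id: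
      "\<lbrakk>\<omega> \<in> space M; 0 \<le> s\<rbrakk> \<Longrightarrow> ereal s < \<Theta> s x \<omega> \<and> \<phi> s s x \<omega> = x"

locale continuous_local_semi_flow = local_semi_flow M \<phi> \<Theta>
  for M :: "'w measure"
    and \<phi> :: "real \<Rightarrow> real \<Rightarrow> 'a::polish_space \<Rightarrow> 'w \<Rightarrow> 'a"
    and \<Theta> :: "real \<Rightarrow> 'a \<Rightarrow> 'w \<Rightarrow> ereal" +
  assumes flow_continuous:
    "\<lbrakk>\<omega> \<in> space M; 0 \<le> s; s \<le> t\<rbrakk>
      \<Longrightarrow> continuous_on {x. ereal t < \<Theta> s x \<omega>} (\<lambda>x. \<phi> s t x \<omega>)"

locale global_semi_flow = local_semi_flow M \<phi> \<Theta>
  for M :: "'w measure"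
    and \<phi> :: "real \<Rightarrow> real \<Rightarrow> 'a::polish_space \<Rightarrow> 'w \<Rightarrow> 'a"
    and \<Theta> :: "real \<Rightarrow> 'a \<Rightarrow> 'w \<Rightarrow> ereal" +
  assumes flow_global: "\<lbrakk>\<omega> \<in> space M; 0 \<le> s\<rbrakk> \<Longrightarrow> \<Theta> s x \<omega> = \<infinity>"

locale local_rds = metric_dynamical_system M \<theta>
  for M :: "'w measure"
    and \<theta> :: "real \<Rightarrow> 'w \<Rightarrow> 'w" +
  fixes \<phi> :: "real \<Rightarrow> 'a::polish_space \<Rightarrow> 'w \<Rightarrow> 'a"
    and \<tau> :: "'a \<Rightarrow> 'w \<Rightarrow> ereal"
  assumes explosion_pos: "\<omega> \<in> space M \<Longrightarrow> 0 < \<tau> x \<omega>"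
    and explosion_measurable: "(\<lambda>(x, \<omega>). \<tau> x \<omega>) \<in> measurable (borel \<Otimes>\<^sub>M M) borel"
    and rds_measurable:
      "(\<lambda>(t, x, \<omega>). \<phi> t x \<omega>) \<in> measurable
        (restrict_space (borel \<Otimes>\<^sub>M borel \<Otimes>\<^sub>M M)
          {(t, x, \<omega>). 0 \<le> t \<and> ereal t < \<tau> x \<omega> \<and> \<omega> \<in> space M}) borel"
    and explosion_lsc: "\<omega> \<in> space M \<Longrightarrow> lower_semicontinuous_on UNIV (\<lambda>x. \<tau> x \<omega>)"
    and rds_right_cont:
      "\<lbrakk>\<omega> \<in> space M; 0 \<le> t; ereal t < \<tau> x \<omega>\<rbrakk>
        \<Longrightarrow> continuous (at_right t) (\<lambda>r. \<phi> r x \<omega>)"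
    and explosion_shift:
      "\<lbrakk>\<omega> \<in> space M; 0 \<le> s; ereal s < \<tau> x \<omega>\<rbrakk>
        \<Longrightarrow> \<tau> (\<phi> s x \<omega>) (\<theta> s \<omega>) + ereal s = \<tau> x \<omega>"
    and rds_zero: "\<omega> \<in> space M \<Longrightarrow> \<phi> 0 x \<omega> = x"
    and rds_cocycle:
      "\<lbrakk>\<omega> \<in> space M; 0 \<le> s; 0 \<le> t; ereal (t + s) < \<tau> x \<omega>\<rbrakk>
        \<Longrightarrow> \<phi> (t + s) x \<omega> = \<phi> t (\<phi> s x \<omega>) (\<theta> s \<omega>)"

locale continuous_local_rds = local_rds M \<theta> \<phi> \<tau>
  for M :: "'w measure"
    and \<theta> :: "real \<Rightarrow> 'w \<Rightarrow> 'w"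
    and \<phi> :: "real \<Rightarrow> 'a::polish_space \<Rightarrow> 'w \<Rightarrow> 'a"
    and \<tau> :: "'a \<Rightarrow> 'w \<Rightarrow> ereal" +
  assumes rds_continuous:
    "\<lbrakk>\<omega> \<in> space M; 0 \<le> t\<rbrakk> \<Longrightarrow> continuous_on {x. ereal t < \<tau> x \<omega>} (\<lambda>x. \<phi> t x \<omega>)"

locale global_rds = local_rds M \<theta> \<phi> \<tau>
  for M :: "'w measure"
    and \<theta> :: "real \<Rightarrow> 'w \<Rightarrow> 'w"
    and \<phi> :: "real \<Rightarrow> 'a::polish_space \<Rightarrow> 'w \<Rightarrow> 'a"
    and \<tau> :: "'a \<Rightarrow> 'w \<Rightarrow> ereal" +
  assumes rds_global: "\<omega> \<in> space M \<Longrightarrow> \<tau> x \<omega> = \<infinity>"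

text \<open>
  The set of agreement need not be measurable (it involves all \<open>x\<close>), hence the inner measure.
\<close>

definition indistinguishable ::
  "'w measure \<Rightarrow> (real \<Rightarrow> 'a \<Rightarrow> 'w \<Rightarrow> 'a) \<Rightarrow> ('a \<Rightarrow> 'w \<Rightarrow> ereal)
    \<Rightarrow> (real \<Rightarrow> 'a \<Rightarrow> 'w \<Rightarrow> 'a) \<Rightarrow> ('a \<Rightarrow> 'w \<Rightarrow> ereal) \<Rightarrow> bool" where
  "indistinguishable M \<psi> \<sigma> \<phi> \<tau> \<longleftrightarrow>
    inner_measure M {\<omega> \<in> space M.
      (\<forall>x. \<tau> x \<omega> = \<sigma> x \<omega>) \<and>
      (\<forall>x t. 0 \<le> t \<and> ereal t < \<tau> x \<omega> \<longrightarrow> \<phi> t x \<omega> = \<psi> t x \<omega>)} = 1"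

end

theory Submission
  imports Defs
begin

text \<open>
  Call \<open>(s, \<omega>)\<close> bad if the crude cocycle identities fail at time \<open>s\<close> for some \<open>x\<close> and \<open>t\<close>. The bad set
  is the projection along the Polish space of all \<open>(t, x)\<close> of a measurable set, so it is measurable
  with respect to the completed product measure. As its sections in \<open>\<omega>\<close> are null, Fubini's theorem
  gives an almost sure event \<open>G\<close> such that for each \<open>\<omega> \<in> G\<close> almost every time \<open>s \<ge> 0\<close> is not bad.
  Almost every \<open>\<omega>\<close> belongs to the \<open>\<theta>\<close>-invariant event that \<open>\<theta> (- r) \<omega> \<in> G\<close> for almost every real
  \<open>r\<close>. There \<open>\<phi> r (r + t) x (\<theta> (- r) \<omega>)\<close> and \<open>\<Theta> r x (\<theta> (- r) \<omega>) - r\<close> do not depend on the choice of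
  \<open>r \<ge> 0\<close> with \<open>\<theta> (- r) \<omega> \<in> G\<close>, and these values define the perfect version (the trivial flow is used
  off this event). With \<open>r\<close> for \<open>\<omega>\<close> and \<open>r + s\<close> for \<open>\<theta> s \<omega>\<close>, both refer to the same noise
  \<open>\<theta> (- r) \<omega>\<close>, and the cocycle property becomes the flow property.
\<close>

section \<open>Souslin schemes and measurable projection\<close>

text \<open>This is the Souslin operation: the union over all infinite branches
  \<open>\<sigma>\<close> of the intersection of \<open>P\<close> along the initial segments of
  \<open>\<sigma>\<close>. The union is uncountable, so the result can leave the \<sigma>-field of
  the sets \<open>P s\<close>.\<close>

definition souslin :: "(nat list \<Rightarrow> 'a set) \<Rightarrow> 'a set" where
  "souslin P = {z. \<exists>\<sigma>. \<forall>n. z \<in> P (map \<sigma> [0..<n])}"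

definition souslin_sets :: "'a set set \<Rightarrow> 'a set set" where
  "souslin_sets G = {souslin P |P. range P \<subseteq> G}"

lemma souslin_sets_basic: "A \<in> G \<Longrightarrow> A \<in> souslin_sets G"
  unfolding souslin_sets_def souslin_def by (auto intro!: exI[of _ "\<lambda>_. A"])

text \<open>The first entry of a branch selects \<open>k\<close>, and the rest is a branch for
  \<open>A k\<close>. The empty list must get a member of \<open>G\<close> that imposes no
  constraint, which is why \<open>\<Union> G\<close> has to belong to \<open>G\<close>.\<close>

lemma souslin_sets_UN:
  fixes A :: "nat \<Rightarrow> 'a set"
  assumes A: "\<And>k. A k \<in> souslin_sets G" and Z: "\<Union> G \<in> G"
  shows "(\<Union>k. A k) \<in> souslin_sets G"
proof -
  from A have "\<forall>k. \<exists>P. range P \<subseteq> G \<and> A k = souslin P"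
    unfolding souslin_sets_def by blast
  then obtain P where P: "\<And>k s. P k s \<in> G" "\<And>k. A k = souslin (P k)"
    by (metis rangeI subsetD)
  define Q where "Q s = (case s of [] \<Rightarrow> \<Union> G | k # s \<Rightarrow> P k s)" for s
  have "range Q \<subseteq> G"
    using P(1) Z by (auto simp: Q_def split: list.splits)
  moreover have "(\<Union>k. A k) = souslin Q"
  proof (intro set_eqI iffI)
    fix z assume "z \<in> (\<Union>k. A k)"
    then obtain k \<sigma> where \<sigma>: "\<And>n. z \<in> P k (map \<sigma> [0..<n])"
      using P(2) by (auto simp: souslin_def)
    have "z \<in> Q (map (case_nat k \<sigma>) [0..<n])" for n
    proof (cases n)
      case 0
      then show ?thesis
        using \<sigma>[of 0] P(1)[of k "[]"] by (auto simp: Q_def)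
    next
      case (Suc m)
      then show ?thesis
        using \<sigma>[of m] by (simp add: Q_def map_upt_Suc del: upt_Suc)
    qed
    then show "z \<in> souslin Q"
      unfolding souslin_def by blast
  next
    fix z assume "z \<in> souslin Q"
    then obtain \<sigma> where \<sigma>: "\<And>n. z \<in> Q (map \<sigma> [0..<n])"
      by (auto simp: souslin_def)
    have "z \<in> P (\<sigma> 0) (map (\<lambda>i. \<sigma> (Suc i)) [0..<n])" for n
      using \<sigma>[of "Suc n"] by (simp add: Q_def map_upt_Suc del: upt_Suc)
    then show "z \<in> (\<Union>k. A k)"
      using P(2) by (auto simp: souslin_def)
  qed
  ultimately show ?thesis
    unfolding souslin_sets_def by blast
qed

text \<open>One branch codes a whole sequence of branches, the entry at
  \<open>prod_encode (k, i)\<close> being entry \<open>i\<close> of the branch for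
  \<open>A k\<close>. Stage \<open>prod_encode (k, n)\<close> of \<open>Q\<close> tests stage
  \<open>n\<close> of the scheme of \<open>A k\<close>, so each stage of each scheme is tested
  exactly once.\<close>

lemma souslin_sets_INT:
  fixes A :: "nat \<Rightarrow> 'a set"
  assumes A: "\<And>k. A k \<in> souslin_sets G"
  shows "(\<Inter>k. A k) \<in> souslin_sets G"
proof -
  from A have "\<forall>k. \<exists>P. range P \<subseteq> G \<and> A k = souslin P"
    unfolding souslin_sets_def by blast
  then obtain P where P: "\<And>k s. P k s \<in> G" "\<And>k. A k = souslin (P k)"
    by (metis rangeI subsetD)
  define Q where "Q s = (case prod_decode (length s) of
    (k, n) \<Rightarrow> P k (map (\<lambda>i. s ! prod_encode (k, i)) [0..<n]))" for s
  \<comment> \<open>The entries that are read at stage \<open>prod_encode (k, n)\<close> must lie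
    before that position.\<close>
  have less: "prod_encode (k, i) < prod_encode (k, n)" if "i < n" for k i n
  proof -
    have "prod_encode (k, j) < prod_encode (k, Suc j)" for j
      by (simp add: prod_encode_def triangle_Suc)
    then show ?thesis
      using that by (rule lift_Suc_mono_less)
  qed
  have Q: "Q (map \<sigma> [0..<prod_encode (k, n)]) = P k (map (\<lambda>i. \<sigma> (prod_encode (k, i))) [0..<n])"
    for \<sigma> k n
    using less by (auto simp: Q_def intro!: arg_cong[where f = "P k"])
  have "range Q \<subseteq> G"
    using P(1) by (auto simp: Q_def split: prod.splits)
  moreover have "(\<Inter>k. A k) = souslin Q"
  proof (intro set_eqI iffI)
    fix z assume "z \<in> (\<Inter>k. A k)"
    then have "\<forall>k. \<exists>\<sigma>. \<forall>n. z \<in> P k (map \<sigma> [0..<n])"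
      using P(2) by (auto simp: souslin_def)
    then obtain \<sigma> where \<sigma>: "\<And>k n. z \<in> P k (map (\<sigma> k) [0..<n])"
      by metis
    define \<rho> where "\<rho> m = case_prod \<sigma> (prod_decode m)" for m
    have "z \<in> Q (map \<rho> [0..<m])" for m
      using Q[of \<rho> "fst (prod_decode m)" "snd (prod_decode m)"] \<sigma> by (simp add: \<rho>_def)
    then show "z \<in> souslin Q"
      unfolding souslin_def by blast
  next
    fix z assume "z \<in> souslin Q"
    then obtain \<sigma> where \<sigma>: "\<And>n. z \<in> Q (map \<sigma> [0..<n])"
      by (auto simp: souslin_def)
    have "z \<in> P k (map (\<lambda>i. \<sigma> (prod_encode (k, i))) [0..<n])" for k n
      using \<sigma>[of "prod_encode (k, n)"] by (simp add: Q)
    then show "z \<in> (\<Inter>k. A k)"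
      using P(2) by (auto simp: souslin_def)
  qed
  ultimately show ?thesis
    unfolding souslin_sets_def by blast
qed

text \<open>Koenig's lemma, applied to the finitely branching tree of the sequences bounded by \<open>f\<close>.\<close>

lemma souslin_boundedI:
  fixes P :: "nat list \<Rightarrow> 'a set"
  assumes "\<And>k. \<exists>s. length s = k \<and> (\<forall>i<k. s ! i \<le> f i) \<and> (\<forall>j\<le>k. e \<in> P (take j s))"
  shows "e \<in> souslin P"
proof -
  define T where "T s \<longleftrightarrow> (\<forall>i<length s. s ! i \<le> f i) \<and> (\<forall>j\<le>length s. e \<in> P (take j s))" for s
  have T_take: "T (take j s)" if "T s" for j s
    using that by (auto simp: T_def min_def)
  \<comment> \<open>\<open>L s\<close> says that \<open>s\<close> has extensions in the tree of
    every greater length; a branch is built by keeping this property alive.\<close>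
  define L where "L s \<longleftrightarrow> (\<forall>k\<ge>length s. \<exists>t. length t = k \<and> T t \<and> take (length s) t = s)" for s
  have "\<exists>m. L (s @ [m])" if "L s" for s
  proof (rule ccontr)
    assume "\<nexists>m. L (s @ [m])"
    then have "\<exists>k\<ge>Suc (length s). \<forall>t. length t = k \<longrightarrow> T t \<longrightarrow> take (Suc (length s)) t \<noteq> s @ [m]" for m
      unfolding L_def by (metis length_append_singleton)
    then obtain K where K: "\<And>m. Suc (length s) \<le> K m"
      "\<And>m t. length t = K m \<Longrightarrow> T t \<Longrightarrow> take (Suc (length s)) t \<noteq> s @ [m]"
      by metis
    \<comment> \<open>Past length \<open>K m\<close> no extension continues with \<open>m\<close>.
      Only the finitely many \<open>m \<le> f (length s)\<close> can occur, so no extension has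
      length \<open>k\<close>.\<close>
    define k where "k = Max (K ` {..f (length s)})"
    have K_le: "K m \<le> k" if "m \<le> f (length s)" for m
      unfolding k_def using that by (intro Max_ge) auto
    have "Suc (length s) \<le> k"
      using K(1)[of 0] K_le[of 0] by simp
    then obtain t where t: "length t = k" "T t" "take (length s) t = s"
      using \<open>L s\<close> unfolding L_def by (metis Suc_leD)
    define m where "m = t ! length s"
    have "m \<le> f (length s)"
      using t \<open>Suc (length s) \<le> k\<close> by (auto simp: T_def m_def)
    then have "length (take (K m) t) = K m"
      using K_le t(1) by simp
    moreover have "take (Suc (length s)) (take (K m) t) = s @ [m]"
      using K(1)[of m] t \<open>Suc (length s) \<le> k\<close> by (simp add: min_absorb1 take_Suc_conv_app_nth m_def)
    ultimately show False
      using K(2) T_take[OF t(2)] by blast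
  qed
  moreover have "L []"
    unfolding L_def T_def using assms by auto (metis order.refl)
  ultimately have "\<exists>S. \<forall>n. (length (S n) = n \<and> L (S n)) \<and> (\<exists>m. S (Suc n) = S n @ [m])"
    by (intro dependent_nat_choice) (simp, metis length_append_singleton)
  then obtain S where S: "\<And>n. length (S n) = n" "\<And>n. L (S n)" "\<And>n. \<exists>m. S (Suc n) = S n @ [m]"
    by blast
  define \<sigma> where "\<sigma> n = last (S (Suc n))" for n
  have "S n = map \<sigma> [0..<n]" for n
  proof (induction n)
    case 0
    then show ?case using S(1)[of 0] by simp
  next
    case (Suc n)
    then show ?case using S(3)[of n] by (auto simp: \<sigma>_def)
  qed
  moreover have "e \<in> P (S n)" for n
  proof -
    obtain t where "length t = n" "T t" "take n t = S n"
      using S(2)[of n] S(1)[of n] by (auto simp: L_def)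
    then show ?thesis
      by (force simp: T_def)
  qed
  ultimately have "\<forall>n. e \<in> P (map \<sigma> [0..<n])"
    by metis
  then show ?thesis
    unfolding souslin_def by (intro CollectI exI)
qed

section \<open>Measurability of Souslin sets for the completion\<close>

text \<open>A capacitability argument. Continuity of the outer measure from below bounds the branch
  entries one after the other by \<open>f\<close> while the outer measure stays above
  \<open>c\<close>. The measurable finite-stage sets for \<open>f\<close> decrease, so their
  intersection still has measure at least \<open>c\<close>, and Koenig's lemma puts it inside the
  Souslin set.\<close>

lemma (in finite_measure) souslin_inner_approx:
  assumes P: "\<And>s. P s \<in> sets M" and c: "c < outer_measure_of M (souslin P)"
  shows "\<exists>K\<in>sets M. K \<subseteq> souslin P \<and> c \<le> emeasure M K"
proof -
  \<comment> \<open>Only the first \<open>length l\<close> entries of the branch are bounded; the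
    later ones are free. These sets need not be measurable, hence the outer measure.\<close>
  define A where "A l = {e. \<exists>\<sigma>. (\<forall>i<length l. \<sigma> i \<le> l ! i) \<and> (\<forall>n. e \<in> P (map \<sigma> [0..<n]))}" for l
  have A_space: "A l \<subseteq> space M" for l
    using sets.sets_into_space[OF P] by (auto simp: A_def)
  have A_Un: "A l = (\<Union>m. A (l @ [m]))" for l
  proof (intro equalityI subsetI)
    fix e assume "e \<in> A l"
    then obtain \<sigma> where "\<forall>i<length l. \<sigma> i \<le> l ! i" "\<forall>n. e \<in> P (map \<sigma> [0..<n])"
      by (auto simp: A_def)
    then have "e \<in> A (l @ [\<sigma> (length l)])"
      by (auto simp: A_def nth_append less_Suc_eq intro!: exI[of _ \<sigma>])
    then show "e \<in> (\<Union>m. A (l @ [m]))" by blast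
  next
    fix e assume "e \<in> (\<Union>m. A (l @ [m]))"
    then obtain m \<sigma> where "\<forall>i<Suc (length l). \<sigma> i \<le> (l @ [m]) ! i" "\<forall>n. e \<in> P (map \<sigma> [0..<n])"
      by (auto simp: A_def)
    then show "e \<in> A l"
      unfolding A_def by (auto simp: nth_append less_Suc_eq intro!: exI[of _ \<sigma>])
  qed
  have A_inc: "incseq (\<lambda>m. A (l @ [m]))" for l
  proof (rule monoI, rule subsetI)
    fix m n e assume "m \<le> n" "e \<in> A (l @ [m])"
    then obtain \<sigma> where \<sigma>: "\<forall>i<length (l @ [m]). \<sigma> i \<le> (l @ [m]) ! i" "\<forall>n. e \<in> P (map \<sigma> [0..<n])"
      by (auto simp: A_def)
    have "\<sigma> i \<le> (l @ [n]) ! i" if "i < length (l @ [n])" for i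
      using \<sigma>(1)[rule_format, of i] that \<open>m \<le> n\<close> by (auto simp: nth_append split: if_splits)
    with \<sigma>(2) show "e \<in> A (l @ [n])"
      by (auto simp: A_def)
  qed
  have "\<exists>m. c < outer_measure_of M (A (l @ [m]))" if "c < outer_measure_of M (A l)" for l
    using that unfolding A_Un[of l] SUP_outer_measure_of_incseq[OF A_space A_inc, symmetric]
    by (simp add: less_SUP_iff)
  moreover have "A [] = souslin P"
    by (simp add: A_def souslin_def)
  ultimately have "\<exists>S. \<forall>n. (length (S n) = n \<and> c < outer_measure_of M (A (S n))) \<and>
      (\<exists>m. S (Suc n) = S n @ [m])"
    using c by (intro dependent_nat_choice) (simp, metis length_append_singleton)
  then obtain S where S: "\<And>n. length (S n) = n" "\<And>n. c < outer_measure_of M (A (S n))"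
      "\<And>n. \<exists>m. S (Suc n) = S n @ [m]"
    by blast
  define f where "f n = last (S (Suc n))" for n
  have S_eq: "S n = map f [0..<n]" for n
  proof (induction n)
    case 0
    then show ?case using S(1)[of 0] by simp
  next
    case (Suc n)
    then show ?case using S(3)[of n] by (auto simp: f_def)
  qed
  \<comment> \<open>Only stages up to \<open>k\<close> are tested, so finite sequences replace
    branches and the set is measurable.\<close>
  define K where "K k = (\<Union>s\<in>{s. length s = k \<and> (\<forall>i<k. s ! i \<le> f i)}. \<Inter>j\<in>{..k}. P (take j s))" for k
  have "(\<Inter>j\<in>{..k}. P (take j s)) \<in> sets M" for k s
    using P by (intro sets.finite_INT) auto
  then have K_sets: "K k \<in> sets M" for k
    unfolding K_def by (intro sets.countable_UN') auto
  have "decseq K"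
  proof (rule decseq_SucI, rule subsetI)
    fix k e assume "e \<in> K (Suc k)"
    then obtain s where s: "length s = Suc k" "\<forall>i<Suc k. s ! i \<le> f i" "\<forall>j\<le>Suc k. e \<in> P (take j s)"
      by (auto simp: K_def)
    have "e \<in> P (take j (take k s))" if "j \<le> k" for j
      using s(3) that by (simp add: min_absorb1)
    moreover have "length (take k s) = k" "\<forall>i<k. take k s ! i \<le> f i"
      using s by auto
    ultimately show "e \<in> K k"
      unfolding K_def by blast
  qed
  have "A (S k) \<subseteq> K k" for k
  proof
    fix e assume "e \<in> A (S k)"
    then obtain \<sigma> where \<sigma>: "\<forall>i<k. \<sigma> i \<le> f i" "\<forall>n. e \<in> P (map \<sigma> [0..<n])"
      by (auto simp: A_def S_eq)
    then have "e \<in> P (take j (map \<sigma> [0..<k]))" if "j \<le> k" for j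
      using that by (simp add: take_map min_absorb1)
    with \<sigma>(1) show "e \<in> K k"
      unfolding K_def by (intro UN_I[of "map \<sigma> [0..<k]"]) auto
  qed
  then have "c \<le> emeasure M (K k)" for k
    using S(2)[of k] outer_measure_of_mono[of "A (S k)" "K k" M] K_sets by fastforce
  then have "c \<le> (INF k. emeasure M (K k))"
    by (intro INF_greatest)
  also have "\<dots> = emeasure M (\<Inter>k. K k)"
    using K_sets \<open>decseq K\<close> by (intro INF_emeasure_decseq) auto
  finally have "c \<le> emeasure M (\<Inter>k. K k)" .
  moreover have "(\<Inter>k. K k) \<subseteq> souslin P"
  proof
    fix e assume "e \<in> (\<Inter>k. K k)"
    have "\<exists>s. length s = k \<and> (\<forall>i<k. s ! i \<le> f i) \<and> (\<forall>j\<le>k. e \<in> P (take j s))" for k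
    proof -
      have "e \<in> K k"
        using \<open>e \<in> (\<Inter>k. K k)\<close> by blast
      then obtain s where "length s = k" "\<forall>i<k. s ! i \<le> f i" "\<forall>j\<le>k. e \<in> P (take j s)"
        by (auto simp: K_def)
      then show ?thesis
        by blast
    qed
    then show "e \<in> souslin P"
      by (rule souslin_boundedI)
  qed
  ultimately show ?thesis
    using K_sets by blast
qed

text \<open>The set is enclosed between a measurable hull \<open>E\<close> with the same outer
  measure and a countable union \<open>L\<close> of measurable subsets. Inner approximation gives
  both the same finite measure, so \<open>E - L\<close> is null.\<close>

lemma (in finite_measure) souslin_completion:
  assumes P: "\<And>s. P s \<in> sets M"
  shows "souslin P \<in> sets (completion M)"
proof -
  let ?A = "souslin P"
  have "?A \<subseteq> space M"
    using sets.sets_into_space[OF P] by (auto simp: souslin_def)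
  then obtain E where E: "E \<in> sets M" "?A \<subseteq> E" "outer_measure_of M ?A = emeasure M E"
    using outer_measure_of_attain[of ?A M] by auto
  define m where "m = (SUP K\<in>{K \<in> sets M. K \<subseteq> ?A}. emeasure M K)"
  obtain K :: "nat \<Rightarrow> 'a set" where K: "\<And>n. K n \<in> sets M" "\<And>n. K n \<subseteq> ?A"
      "m = (SUP n. emeasure M (K n))"
  proof -
    have "emeasure M ` {K \<in> sets M. K \<subseteq> ?A} \<noteq> {}" by auto
    from ennreal_Sup_countable_SUP[OF this] obtain g :: "nat \<Rightarrow> ennreal" where
      g: "range g \<subseteq> emeasure M ` {K \<in> sets M. K \<subseteq> ?A}" "m = (SUP n. g n)"
      unfolding m_def by auto
    then have "\<forall>n. \<exists>K. K \<in> sets M \<and> K \<subseteq> ?A \<and> g n = emeasure M K" by blast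
    then obtain K where "\<And>n. K n \<in> sets M \<and> K n \<subseteq> ?A \<and> g n = emeasure M (K n)" by metis
    with g that[of K] show ?thesis by simp
  qed
  define L where "L = (\<Union>n. K n)"
  have L: "L \<in> sets M" "L \<subseteq> ?A"
    using K by (auto simp: L_def)
  have "emeasure M E \<le> m"
  proof (rule dense_le)
    fix c assume "c < emeasure M E"
    then obtain K' where "K' \<in> sets M" "K' \<subseteq> ?A" "c \<le> emeasure M K'"
      using souslin_inner_approx[of P c] P E(3) by auto
    then show "c \<le> m"
      unfolding m_def by (intro SUP_upper2[of K']) simp_all
  qed
  also have "m \<le> emeasure M L"
    unfolding K(3) L_def using K(1) by (intro SUP_least emeasure_mono) auto
  finally have "emeasure M E \<le> emeasure M L" .
  then have "emeasure M (E - L) = 0"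
    using E L by (subst emeasure_Diff) (auto simp: diff_eq_0_iff_ennreal less_top[symmetric])
  then have "E - L \<in> null_sets M"
    using E L by auto
  then show ?thesis
    using L E by (intro sets_completionI[of _ L "?A - L" "E - L"]) auto
qed


section \<open>Measurable sets in a product as Souslin sets, and their projections\<close>

lemma open_eq_UN_closed:
  fixes U :: "'a::metric_space set"
  assumes "open U"
  shows "\<exists>C::nat \<Rightarrow> 'a set. (\<forall>n. closed (C n)) \<and> U = (\<Union>n. C n)"
proof (cases "U = UNIV")
  case True
  then show ?thesis
    by (intro exI[of _ "\<lambda>_. UNIV"]) simp
next
  case False
  define C where "C n = {x. inverse (real (Suc n)) \<le> infdist x (- U)}" for n
  have "closed (C n)" for n
    unfolding C_def by (intro closed_Collect_le continuous_intros)
  moreover have "U = (\<Union>n. C n)"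
  proof -
    have "x \<in> U \<longleftrightarrow> 0 < infdist x (- U)" for x
      using in_closed_iff_infdist_zero[of "- U" x] False assms infdist_nonneg[of x "- U"]
      by (auto simp: less_le)
    moreover have "0 < infdist x (- U) \<longleftrightarrow> (\<exists>n. x \<in> C n)" for x
      unfolding C_def using reals_Archimedean[of "infdist x (- U)"]
      by (auto intro: less_imp_le less_le_trans[rotated])
    ultimately show ?thesis
      by auto
  qed
  ultimately show ?thesis
    by (intro exI[of _ C]) simp
qed

text \<open>Souslin sets are not closed under complements, so the argument runs over the sets that
  are Souslin together with their complement. By the closure lemmas these form a \<sigma>-field. It
  contains the cylinders over open sets, which are countable unions of closed ones, and those over
  \<open>sets E\<close>.\<close>

lemma sets_borel_pair_souslin:
  fixes B :: "('y::metric_space \<times> 'e) set"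
  assumes "B \<in> sets (borel \<Otimes>\<^sub>M E)"
  shows "B \<in> souslin_sets {C \<times> S |C S. closed C \<and> S \<in> sets E}"
proof -
  define G :: "('y \<times> 'e) set set" where "G = {C \<times> S |C S. closed C \<and> S \<in> sets E}"
  define Z :: "('y \<times> 'e) set" where "Z = UNIV \<times> space E"
  define D where "D = {A. A \<subseteq> Z \<and> A \<in> souslin_sets G \<and> Z - A \<in> souslin_sets G}"
  have Times_G: "C \<times> S \<in> souslin_sets G" if "closed C" "S \<in> sets E" for C S
    using that by (intro souslin_sets_basic) (auto simp: G_def)
  have "Z \<in> G"
    unfolding G_def Z_def by (intro CollectI exI[of _ UNIV] exI[of _ "space E"]) simp
  moreover have "A \<subseteq> Z" if "A \<in> G" for A
    using that by (auto simp: G_def Z_def dest: sets.sets_into_space)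
  ultimately have "\<Union> G = Z"
    by blast
  with \<open>Z \<in> G\<close> have UnG: "\<Union> G \<in> G"
    by simp
  have D: "sigma_algebra Z D"
    unfolding sigma_algebra_iff2
  proof (intro conjI ballI allI impI)
    show "D \<subseteq> Pow Z"
      by (auto simp: D_def)
    show "{} \<in> D"
      using Times_G[of "{}" "{}"] souslin_sets_basic[OF \<open>Z \<in> G\<close>] by (simp add: D_def)
  next
    fix A assume "A \<in> D"
    then show "Z - A \<in> D"
      by (auto simp: D_def double_diff)
  next
    fix A :: "nat \<Rightarrow> _" assume A: "range A \<subseteq> D"
    have "(\<Union>n. A n) \<in> souslin_sets G"
      using A by (intro souslin_sets_UN UnG) (auto simp: D_def)
    moreover have "(\<Inter>n. Z - A n) \<in> souslin_sets G"
      using A by (intro souslin_sets_INT) (auto simp: D_def)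
    moreover have "Z - (\<Union>n. A n) = (\<Inter>n. Z - A n)"
      by auto
    moreover have "(\<Union>n. A n) \<subseteq> Z"
      using A by (auto simp: D_def)
    ultimately show "(\<Union>n. A n) \<in> D"
      unfolding D_def by (intro CollectI conjI) (simp_all only:)
  qed
  \<comment> \<open>With \<open>D\<close> as a \<sigma>-field, the inclusion of the product
    \<sigma>-field becomes measurability of the identity, that is, of both coordinates.\<close>
  define N where "N = sigma Z D"
  have N: "space N = Z" "sets N = D"
    unfolding N_def using D
    by (rule sigma_algebra.space_measure_of_eq, rule sigma_algebra.sets_measure_of_eq)
  have "fst \<in> borel_measurable N"
  proof (rule borel_measurableI)
    fix U :: "'y set" assume "open U"
    then obtain C :: "nat \<Rightarrow> 'y set" where C: "\<forall>n. closed (C n)" "U = (\<Union>n. C n)"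
      using open_eq_UN_closed by metis
    have "(\<Union>n. C n \<times> space E) \<in> souslin_sets G"
      using C(1) by (intro souslin_sets_UN UnG Times_G) auto
    moreover have "(- U) \<times> space E \<in> souslin_sets G"
      using \<open>open U\<close> by (intro Times_G) auto
    moreover have "fst -` U \<inter> Z = (\<Union>n. C n \<times> space E)" "Z - fst -` U \<inter> Z = (- U) \<times> space E"
      using C(2) by (auto simp: Z_def)
    moreover have "fst -` U \<inter> Z \<subseteq> Z"
      by blast
    ultimately show "fst -` U \<inter> space N \<in> sets N"
      by (simp add: N D_def)
  qed
  moreover have "snd \<in> measurable N E"
  proof (rule measurableI)
    show "snd z \<in> space E" if "z \<in> space N" for z
      using that by (auto simp: N Z_def)
    fix S assume S: "S \<in> sets E"
    have "snd -` S \<inter> Z = UNIV \<times> S" "Z - snd -` S \<inter> Z = UNIV \<times> (space E - S)"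
      using sets.sets_into_space[OF S] by (auto simp: Z_def)
    moreover have "UNIV \<times> S \<in> souslin_sets G" "UNIV \<times> (space E - S) \<in> souslin_sets G"
      using S by (auto intro!: Times_G)
    moreover have "snd -` S \<inter> Z \<subseteq> Z"
      by blast
    ultimately show "snd -` S \<inter> space N \<in> sets N"
      by (simp add: N D_def)
  qed
  ultimately have "(\<lambda>z. (fst z, snd z)) \<in> measurable N (borel \<Otimes>\<^sub>M E)"
    by (rule measurable_Pair)
  from measurable_sets[OF this assms] have "B \<inter> Z \<in> D"
    by (simp add: N)
  moreover have "B \<subseteq> Z"
    using sets.sets_into_space[OF assms] by (auto simp: Z_def space_pair_measure)
  ultimately show ?thesis
    by (simp add: D_def G_def Int_absorb2)
qed

text \<open>
  A branch of the scheme of \<open>B\<close> is coded together with indices of dense points that approximate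
  \<open>y\<close>. The closed \<open>y\<close>-parts then shrink to a point along the branch, so by completeness they have a
  common point as soon as all finite stages are nonempty, and the projection is again Souslin.
\<close>

theorem (in finite_measure) measurable_projection:
  fixes B :: "('y::{complete_space, second_countable_topology} \<times> 'a) set"
  assumes B: "B \<in> sets (borel \<Otimes>\<^sub>M M)"
  shows "snd ` B \<in> sets (completion M)"
proof -
  obtain P where P: "\<And>s. P s \<in> {C \<times> S |C S. closed C \<and> S \<in> sets M}" "B = souslin P"
    using sets_borel_pair_souslin[OF B] by (auto simp: souslin_sets_def image_subset_iff)
  then have "\<forall>s. \<exists>C S. P s = C \<times> S \<and> closed C \<and> S \<in> sets M"
    by blast
  then obtain C S where CS: "\<And>s. P s = C s \<times> S s" "\<And>s. closed (C s)" "\<And>s. S s \<in> sets M"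
    by metis
  obtain D :: "'y set" where D: "countable D" "\<And>U. open U \<Longrightarrow> U \<noteq> {} \<Longrightarrow> \<exists>d\<in>D. d \<in> U"
    using countable_dense_exists by blast
  define d where "d = from_nat_into D"
  have dense: "\<exists>n. dist (d n) y \<le> e" if e: "0 < e" for y e
  proof -
    obtain z where "z \<in> D" "dist y z < e"
      using D(2)[of "ball y e"] e by (auto simp: not_le)
    moreover obtain n where "z = d n"
      using from_nat_into_surj[OF D(1) \<open>z \<in> D\<close>] by (auto simp: d_def)
    ultimately show ?thesis
      by (auto simp: dist_commute intro: less_imp_le)
  qed
  \<comment> \<open>Each branch entry is a pair: \<open>p\<close> recovers the entry for the scheme
    \<open>P\<close>, and \<open>q\<close> the index of a dense point.\<close>
  define p q where "p = (\<lambda>m. fst (prod_decode m))" and "q = (\<lambda>m. snd (prod_decode m))"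
  define F where "F s = (\<Inter>j\<in>{..length s}. C (map p (take j s))) \<inter>
    (\<Inter>j\<in>{..<length s}. cball (d (q (s ! j))) ((1/2) ^ j))" for s
  have F_iff: "y \<in> F (map \<kappa> [0..<n]) \<longleftrightarrow> (\<forall>j\<le>n. y \<in> C (map (\<lambda>i. p (\<kappa> i)) [0..<j])) \<and>
      (\<forall>j<n. dist (d (q (\<kappa> j))) y \<le> (1/2) ^ j)" for y \<kappa> n
    by (auto simp: F_def take_map comp_def)
  \<comment> \<open>Only the second factor is kept, but a stage with empty \<open>y\<close>-part is
    discarded, so that a branch of \<open>Q\<close> supplies points \<open>y n\<close> in all its
    \<open>y\<close>-parts.\<close>
  define Q where "Q s = (if F s = {} then {} else S (map p s))" for s
  have "snd ` B = souslin Q"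
  proof (intro equalityI subsetI)
    fix e assume "e \<in> snd ` B"
    then obtain y where "(y, e) \<in> souslin P"
      by (auto simp: P(2))
    then obtain \<sigma> where \<sigma>: "\<And>n. y \<in> C (map \<sigma> [0..<n])" "\<And>n. e \<in> S (map \<sigma> [0..<n])"
      unfolding souslin_def mem_Collect_eq CS(1) mem_Times_iff fst_conv snd_conv by blast
    have "\<exists>m. dist (d m) y \<le> (1/2) ^ n" for n
      by (rule dense) simp
    then obtain \<rho> where \<rho>: "\<And>n. dist (d (\<rho> n)) y \<le> (1/2) ^ n"
      by metis
    define \<kappa> where "\<kappa> n = prod_encode (\<sigma> n, \<rho> n)" for n
    have [simp]: "p (\<kappa> n) = \<sigma> n" "q (\<kappa> n) = \<rho> n" for n
      by (simp_all add: p_def q_def \<kappa>_def)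
    have "y \<in> F (map \<kappa> [0..<n])" for n
      using \<sigma>(1) \<rho> by (simp add: F_iff)
    then have "e \<in> Q (map \<kappa> [0..<n])" for n
      using \<sigma>(2)[of n] by (auto simp: Q_def comp_def)
    then show "e \<in> souslin Q"
      unfolding souslin_def by blast
  next
    fix e assume "e \<in> souslin Q"
    then obtain \<kappa> where \<kappa>: "\<And>n. e \<in> Q (map \<kappa> [0..<n])"
      by (auto simp: souslin_def)
    have "\<forall>n. \<exists>y. y \<in> F (map \<kappa> [0..<n])"
      using \<kappa> unfolding Q_def by (metis all_not_in_conv)
    then obtain y where y: "\<And>n. y n \<in> F (map \<kappa> [0..<n])"
      by metis
    define \<sigma> where "\<sigma> = (\<lambda>n. p (\<kappa> n))"
    have y_C: "y n \<in> C (map \<sigma> [0..<j])" if "j \<le> n" for j n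
      using y[of n] that by (simp add: F_iff \<sigma>_def)
    have y_ball: "dist (d (q (\<kappa> j))) (y n) \<le> (1/2) ^ j" if "j < n" for j n
      using y[of n] that by (simp add: F_iff)
    have "Cauchy y"
    proof (rule metric_CauchyI)
      fix \<epsilon> :: real assume "0 < \<epsilon>"
      then obtain j where j: "(1/2) ^ j < \<epsilon> / 2"
        using real_arch_pow_inv[of "\<epsilon> / 2" "1/2"] by auto
      \<comment> \<open>Ball number \<open>j\<close> constrains \<open>y n\<close> only for
        \<open>n > j\<close>, hence \<open>Suc j\<close>. Two points in it are at most two radii
        apart.\<close>
      have "dist (y m) (y n) < \<epsilon>" if "Suc j \<le> m" "Suc j \<le> n" for m n
        using y_ball[of j m] y_ball[of j n] that j dist_triangle2[of "y m" "y n" "d (q (\<kappa> j))"]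
        by (simp add: dist_commute)
      then show "\<exists>N. \<forall>m\<ge>N. \<forall>n\<ge>N. dist (y m) (y n) < \<epsilon>"
        by blast
    qed
    then obtain l where l: "y \<longlonglongrightarrow> l"
      using Cauchy_convergent convergent_def by blast
    have "l \<in> C (map \<sigma> [0..<j])" for j
    proof (rule Lim_in_closed_set[OF CS(2) _ _ l])
      show "\<forall>\<^sub>F n in sequentially. y n \<in> C (map \<sigma> [0..<j])"
        using y_C eventually_ge_at_top by (rule eventually_mono[rotated])
    qed simp
    moreover have "e \<in> S (map \<sigma> [0..<j])" for j
      using \<kappa>[of j] by (auto simp: Q_def \<sigma>_def comp_def split: if_splits)
    ultimately have "(l, e) \<in> P (map \<sigma> [0..<j])" for j
      by (simp add: CS(1))
    then have "(l, e) \<in> B"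
      unfolding P(2) souslin_def by (intro CollectI exI[of _ \<sigma>] allI)
    then show "e \<in> snd ` B"
      by force
  qed
  moreover have "Q s \<in> sets M" for s
    using CS(3) by (simp add: Q_def)
  ultimately show ?thesis
    using souslin_completion by simp
qed

section \<open>Almost every time and semicontinuity\<close>

text \<open>The condition says that the section of the exceptional set has measure zero, and the
  measure of a section is a measurable function of \<open>x\<close>.\<close>

lemma (in sigma_finite_measure) pred_AE:
  assumes "Measurable.pred (N \<Otimes>\<^sub>M M) (\<lambda>(x, y). P x y)"
  shows "Measurable.pred N (\<lambda>x. AE y in M. P x y)"
proof -
  have "Measurable.pred N (\<lambda>x. emeasure M {y \<in> space M. \<not> P x y} = 0)"
    using assms by measurable
  also have "?this \<longleftrightarrow> ?thesis"
  proof (rule measurable_cong)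
    fix x assume x: "x \<in> space N"
    have "{y \<in> space M. \<not> P x y} \<in> sets M"
      using assms x by measurable
    then show "(emeasure M {y \<in> space M. \<not> P x y} = 0) = (AE y in M. P x y)"
      by (simp add: AE_iff_measurable)
  qed
  finally show ?thesis .
qed

text \<open>\<open>P\<close> need not be measurable, so the translation is applied to a measurable
  null set that covers its exceptions.\<close>

lemma AE_lborel_shift:
  fixes P :: "real \<Rightarrow> bool"
  assumes "AE x in lborel. P x"
  shows "AE x in lborel. P (t + x)"
proof -
  from assms obtain N where N: "N \<in> null_sets lborel" "{x. \<not> P x} \<subseteq> N"
    unfolding eventually_ae_filter by auto
  have "AE x in lborel. x \<notin> N"
    using N(1) by (rule AE_not_in)
  moreover have "Measurable.pred borel (\<lambda>x. x \<notin> N)"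
    using N(1) by auto
  ultimately have "AE x in lborel. t + 1 * x \<notin> N"
    by (intro AE_borel_affine) auto
  then show ?thesis
    by eventually_elim (use N(2) in auto)
qed

lemma AE_lborel_obtain:
  fixes P :: "real \<Rightarrow> bool"
  assumes P: "AE x in lborel. P x" and "a < b"
  shows "\<exists>x. a < x \<and> x < b \<and> P x"
proof (rule ccontr)
  assume "\<nexists>x. a < x \<and> x < b \<and> P x"
  with P have "AE x in lborel. x \<notin> {a<..<b}"
    by (auto elim!: eventually_mono)
  then have "emeasure lborel {a<..<b} = 0"
    by (subst (asm) AE_iff_measurable[OF _ refl]) (auto simp: greaterThanLessThan_def greaterThan_def lessThan_def Int_def)
  with \<open>a < b\<close> show False
    by simp
qed

text \<open>This removes an auxiliary \<open>r\<close> on which the truth value does not depend. The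
  half-line has positive measure, so the quantifier is not vacuous.\<close>

lemma AE_nonneg_const_iff:
  fixes P :: "real \<Rightarrow> bool"
  assumes "AE r in lborel. 0 \<le> r \<longrightarrow> (P r \<longleftrightarrow> c)"
  shows "(AE r in lborel. 0 \<le> r \<longrightarrow> P r) \<longleftrightarrow> c"
proof
  assume "AE r in lborel. 0 \<le> r \<longrightarrow> P r"
  with assms have "AE r::real in lborel. 0 \<le> r \<longrightarrow> c"
    by eventually_elim auto
  then show c
    using AE_lborel_obtain[of "\<lambda>r. 0 \<le> r \<longrightarrow> c" 0 1] by auto
next
  assume c
  from assms show "AE r in lborel. 0 \<le> r \<longrightarrow> P r"
    by eventually_elim (use \<open>c\<close> in auto)
qed

text \<open>Sections of a set in the completion need not be measurable. Fubini's theorem is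
  therefore applied to its measurable part \<open>S\<close>, whose sections are null as well, and
  \<open>N'\<close> covers the rest.\<close>

lemma (in sigma_finite_measure) null_sections_imp_null:
  assumes C: "C \<in> sets (completion (A \<Otimes>\<^sub>M M))"
    and sections: "\<And>s. s \<in> space A \<Longrightarrow> \<exists>N\<in>null_sets M. Pair s -` C \<subseteq> N"
  shows "\<exists>N\<in>null_sets (A \<Otimes>\<^sub>M M). C \<subseteq> N"
proof -
  obtain S N N' where SN: "C = S \<union> N" "N \<subseteq> N'" "N' \<in> null_sets (A \<Otimes>\<^sub>M M)" "S \<in> sets (A \<Otimes>\<^sub>M M)"
    using C by (rule sets_completionE)
  have "emeasure M (Pair s -` S) = 0" if "s \<in> space A" for s
  proof -
    obtain N where "N \<in> null_sets M" "Pair s -` C \<subseteq> N"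
      using sections \<open>s \<in> space A\<close> by blast
    moreover from this SN(1) have "Pair s -` S \<subseteq> N"
      by blast
    ultimately show ?thesis
      by (meson emeasure_eq_0 null_setsD1 null_setsD2)
  qed
  then have "(\<integral>\<^sup>+s. emeasure M (Pair s -` S) \<partial>A) = (\<integral>\<^sup>+s. 0 \<partial>A)"
    by (rule nn_integral_cong)
  then have "emeasure (A \<Otimes>\<^sub>M M) S = 0"
    using SN(4) by (simp add: emeasure_pair_measure_alt)
  then have "S \<union> N' \<in> null_sets (A \<Otimes>\<^sub>M M)"
    using SN(3,4) by (intro null_sets.Un) auto
  then show ?thesis
    using SN(1,2) by blast
qed

text \<open>If the two differences were distinct, the smaller one would be finite and positive, and
  taking it for \<open>T\<close> would separate \<open>a\<close> from \<open>b\<close>. Thus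
  lifetimes can be compared through survival up to positive times.\<close>

lemma ereal_minus_eqI:
  fixes a b :: ereal
  assumes "ereal r < a" "ereal s < b"
    and "\<And>T. 0 < T \<Longrightarrow> ereal (r + T) < a \<longleftrightarrow> ereal (s + T) < b"
  shows "a - ereal r = b - ereal s"
proof (cases a; cases b)
  fix x y assume xy: "a = ereal x" "b = ereal y"
  have "x - r = y - s"
  proof (rule ccontr)
    assume "x - r \<noteq> y - s"
    then consider "x - r < y - s" | "y - s < x - r"
      by linarith
    then show False
      by cases (use assms(3)[of "x - r"] assms(3)[of "y - s"] assms(1,2) xy in auto)
  qed
  then show ?thesis
    using xy by simp
next
  fix x assume "a = ereal x" "b = \<infinity>"
  then show ?thesis
    using assms(1) assms(3)[of "x - r"] by auto
next
  fix y assume "a = \<infinity>" "b = ereal y"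
  then show ?thesis
    using assms(2) assms(3)[of "y - s"] by auto
qed (use assms in auto)

lemma lower_semicontinuous_on_right:
  fixes f :: "real \<times> 'a::topological_space \<Rightarrow> ereal"
  assumes "lower_semicontinuous_on ({0..} \<times> UNIV) f" "0 \<le> s" "a < f (s, x)"
  shows "\<forall>\<^sub>F u in at_right 0. a < f (s + u, x)"
proof -
  obtain W where W: "open W" "{z \<in> {0..} \<times> UNIV. a < f z} = ({0..} \<times> UNIV) \<inter> W"
    using assms(1) unfolding lower_semicontinuous_on_def openin_open by blast
  have "((\<lambda>u. (s + u, x)) \<longlongrightarrow> (s + 0, x)) (at_right 0)"
    by (intro tendsto_intros)
  moreover have "(s + 0, x) \<in> W"
    using assms(2,3) W(2) by auto
  ultimately have "\<forall>\<^sub>F u in at_right 0. (s + u, x) \<in> W"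
    using W(1) by (metis topological_tendstoD)
  moreover have "\<forall>\<^sub>F u :: real in at_right 0. 0 < u"
    by (rule eventually_at_right_less)
  ultimately show ?thesis
  proof eventually_elim
    case (elim u)
    then have "(s + u, x) \<in> ({0..} \<times> UNIV) \<inter> W"
      using \<open>0 \<le> s\<close> by simp
    then show ?case
      unfolding W(2)[symmetric] by simp
  qed
qed

lemma lower_semicontinuous_on_section:
  assumes "lower_semicontinuous_on ({0..} \<times> UNIV) f" "0 \<le> (s::real)"
  shows "open {x. a < f (s, x)}"
proof -
  obtain W where W: "open W" "{z \<in> {0..} \<times> UNIV. a < f z} = ({0..} \<times> UNIV) \<inter> W"
    using assms(1) unfolding lower_semicontinuous_on_def openin_open by blast
  have "{x. a < f (s, x)} = Pair s -` W"
    using W(2) \<open>0 \<le> s\<close> by auto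
  also have "open \<dots>"
    using W(1) by (intro continuous_open_vimage continuous_intros)
  finally show ?thesis .
qed

section \<open>Elementary properties of shifts and semi-flows\<close>

context metric_dynamical_system
begin

lemma measurable_shift [measurable (raw)]:
  assumes "f \<in> borel_measurable N" "g \<in> measurable N M"
  shows "(\<lambda>z. \<theta> (f z) (g z)) \<in> measurable N M"
  using measurable_compose[OF measurable_Pair[OF assms] shift_measurable] by simp

lemma shift_space [simp]:
  assumes "\<omega> \<in> space M"
  shows "\<theta> t \<omega> \<in> space M"
  using measurable_space[OF shift_measurable, of "(t, \<omega>)"] assms by (simp add: space_pair_measure)

lemma AE_shift:
  assumes "AE \<omega> in M. P \<omega>"
  shows "AE \<omega> in M. P (\<theta> t \<omega>)"
proof -
  have "AE \<omega> in distr M M (\<theta> t). P \<omega>"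
    using assms shift_measure_preserving[of t] by metis
  then show ?thesis
    by (rule AE_distrD[rotated]) simp
qed

end

context local_semi_flow
begin

text \<open>Lifetimes are absolute times, so the explosion time is constant along a trajectory. Both
  sides exceed \<open>t\<close>, and beyond \<open>t\<close> the rule \<open>lifetime_iff\<close>
  says that the same times \<open>u\<close> lie below them.\<close>

lemma lifetime_flow:
  assumes "\<omega> \<in> space M" "0 \<le> s" "s \<le> t" "ereal t < \<Theta> s x \<omega>"
  shows "\<Theta> t (\<phi> s t x \<omega>) \<omega> = \<Theta> s x \<omega>"
proof -
  have "\<Theta> t (\<phi> s t x \<omega>) \<omega> - ereal t = \<Theta> s x \<omega> - ereal t"
  proof (rule ereal_minus_eqI)
    show "ereal t < \<Theta> t (\<phi> s t x \<omega>) \<omega>"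
      using flow_id assms by simp
    show "ereal (t + T) < \<Theta> t (\<phi> s t x \<omega>) \<omega> \<longleftrightarrow> ereal (t + T) < \<Theta> s x \<omega>" if "0 < T" for T
      using lifetime_iff[of \<omega> s t "t + T" x] assms that by auto
  qed fact
  then show ?thesis
    by (cases "\<Theta> t (\<phi> s t x \<omega>) \<omega>"; cases "\<Theta> s x \<omega>") auto
qed

text \<open>Measurability is assumed for nonnegative starting times only; \<open>max 0\<close> makes
  the expression meaningful for all real \<open>f z\<close>.\<close>

lemma measurable_lifetime [measurable (raw)]:
  assumes [measurable]: "f \<in> borel_measurable N" "g \<in> borel_measurable N" "h \<in> measurable N M"
  shows "(\<lambda>z. \<Theta> (max 0 (f z)) (g z) (h z)) \<in> borel_measurable N"
proof -
  have "(\<lambda>z. max 0 (f z)) \<in> measurable N (restrict_space borel {0..})"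
    by (intro measurable_restrict_space2) auto
  then have "(\<lambda>z. (max 0 (f z), g z, h z)) \<in>
      measurable N (restrict_space borel {0..} \<Otimes>\<^sub>M borel \<Otimes>\<^sub>M M)"
    by measurable
  from measurable_compose[OF this lifetime_measurable] show ?thesis
    by simp
qed

lemma measurable_lifetime0 [measurable (raw)]:
  assumes "g \<in> borel_measurable N" "h \<in> measurable N M"
  shows "(\<lambda>z. \<Theta> 0 (g z) (h z)) \<in> borel_measurable N"
  using measurable_lifetime[of "\<lambda>_. 0" N g h] assms by simp

text \<open>A constant value off the domain turns measurability on the trace into measurability on
  the whole product. The guard uses \<open>max 0 s\<close> so that it is itself a measurable
  condition.\<close>

definition flow_ext :: "real \<Rightarrow> real \<Rightarrow> 'a \<Rightarrow> 'w \<Rightarrow> 'a" where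
  "flow_ext s t x \<omega> =
    (if 0 \<le> s \<and> s \<le> t \<and> ereal t < \<Theta> (max 0 s) x \<omega> then \<phi> s t x \<omega> else undefined)"

lemma flow_ext_eq: "0 \<le> s \<Longrightarrow> s \<le> t \<Longrightarrow> ereal t < \<Theta> s x \<omega> \<Longrightarrow> flow_ext s t x \<omega> = \<phi> s t x \<omega>"
  by (simp add: flow_ext_def max_def)

lemma measurable_flow_ext [measurable (raw)]:
  assumes [measurable]: "e \<in> borel_measurable N" "f \<in> borel_measurable N"
    "g \<in> borel_measurable N" "h \<in> measurable N M"
  shows "(\<lambda>z. flow_ext (e z) (f z) (g z) (h z)) \<in> borel_measurable N"
proof -
  let ?L = "borel \<Otimes>\<^sub>M borel \<Otimes>\<^sub>M borel \<Otimes>\<^sub>M M :: (real \<times> real \<times> 'a \<times> 'w) measure"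
  let ?D = "{(s, t, x, \<omega>). 0 \<le> s \<and> s \<le> t \<and> ereal t < \<Theta> s x \<omega> \<and> \<omega> \<in> space M}"
  have "{z \<in> space ?L. 0 \<le> fst z \<and> fst z \<le> fst (snd z) \<and>
      ereal (fst (snd z)) < \<Theta> (max 0 (fst z)) (fst (snd (snd z))) (snd (snd (snd z)))} \<in> sets ?L" (is "?E \<in> _")
    by measurable
  also have "?E = ?D \<inter> space ?L"
    by (auto simp: space_pair_measure max_def)
  finally have D: "(\<lambda>z. if z \<in> ?D then (case z of (s, t, x, \<omega>) \<Rightarrow> \<phi> s t x \<omega>) else undefined)
      \<in> borel_measurable ?L"
    using flow_measurable by (subst (asm) measurable_restrict_space_iff[where c = undefined]) auto
  have "(\<lambda>z. (e z, f z, g z, h z)) \<in> measurable N ?L"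
    by measurable
  from measurable_compose[OF this D] have "(\<lambda>z. if (e z, f z, g z, h z) \<in> ?D then \<phi> (e z) (f z) (g z) (h z) else undefined)
      \<in> borel_measurable N"
    by (simp only: prod.case)
  also have "?this \<longleftrightarrow> ?thesis"
    using measurable_space[OF assms(4)]
    by (intro measurable_cong) (auto simp: flow_ext_def max_def)
  finally show ?thesis .
qed

end

section \<open>Perfection of crude cocycles\<close>

locale crude_cocycle = metric_dynamical_system M \<theta> + local_semi_flow M \<phi> \<Theta>
  for M :: "'w measure"
    and \<theta> :: "real \<Rightarrow> 'w \<Rightarrow> 'w"
    and \<phi> :: "real \<Rightarrow> real \<Rightarrow> 'a::polish_space \<Rightarrow> 'w \<Rightarrow> 'a"
    and \<Theta> :: "real \<Rightarrow> 'a \<Rightarrow> 'w \<Rightarrow> ereal" +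
  assumes crude: "\<And>s. 0 \<le> s \<Longrightarrow> \<exists>N \<in> null_sets M. \<forall>x. \<forall>\<omega> \<in> space M - N.
          \<Theta> s x \<omega> = \<Theta> 0 x (\<theta> s \<omega>) + ereal s \<and>
          (\<forall>t. 0 \<le> t \<and> ereal t < \<Theta> s x \<omega> - ereal s \<longrightarrow> \<phi> s (s + t) x \<omega> = \<phi> 0 t x (\<theta> s \<omega>))"
begin

section \<open>Agreement at almost every time\<close>

definition agree :: "real \<Rightarrow> 'w \<Rightarrow> bool" where
  "agree s \<omega> \<longleftrightarrow> (\<forall>x. \<Theta> s x \<omega> = \<Theta> 0 x (\<theta> s \<omega>) + ereal s \<and>
    (\<forall>t. 0 \<le> t \<and> ereal t < \<Theta> s x \<omega> - ereal s \<longrightarrow> \<phi> s (s + t) x \<omega> = \<phi> 0 t x (\<theta> s \<omega>)))"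

text \<open>The pair \<open>(t, x)\<close> comes first because it is the Polish factor to be
  projected out. The predicate is measurable in all variables thanks to \<open>max 0\<close> and
  \<open>flow_ext\<close>, and the two lifetime conditions ensure that \<open>flow_ext\<close> is
  compared only where it equals \<open>\<phi>\<close>.\<close>

definition disagree_at :: "(real \<times> 'a) \<times> real \<times> 'w \<Rightarrow> bool" where
  "disagree_at z = (case z of ((t, x), (s, \<omega>)) \<Rightarrow> 0 \<le> s \<and>
    (\<Theta> (max 0 s) x \<omega> \<noteq> \<Theta> 0 x (\<theta> s \<omega>) + ereal s \<or>
     0 \<le> t \<and> ereal (s + t) < \<Theta> (max 0 s) x \<omega> \<and> ereal t < \<Theta> 0 x (\<theta> s \<omega>) \<and>
       flow_ext s (s + t) x \<omega> \<noteq> flow_ext 0 t x (\<theta> s \<omega>)))"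

lemma agree_iff:
  assumes "0 \<le> s"
  shows "\<not> agree s \<omega> \<longleftrightarrow> (\<exists>t x. disagree_at ((t, x), (s, \<omega>)))"
proof -
  have "\<not> (\<Theta> s x \<omega> = \<Theta> 0 x (\<theta> s \<omega>) + ereal s \<and>
      (\<forall>t. 0 \<le> t \<and> ereal t < \<Theta> s x \<omega> - ereal s \<longrightarrow> \<phi> s (s + t) x \<omega> = \<phi> 0 t x (\<theta> s \<omega>))) \<longleftrightarrow>
    (\<exists>t. disagree_at ((t, x), (s, \<omega>)))" for x
  proof (cases "\<Theta> s x \<omega> = \<Theta> 0 x (\<theta> s \<omega>) + ereal s")
    case False
    then show ?thesis
      using assms by (simp add: disagree_at_def max_def)
  next
    case True
    have *: "ereal t < \<Theta> s x \<omega> - ereal s \<longleftrightarrow> ereal t < \<Theta> 0 x (\<theta> s \<omega>)"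
      "ereal (s + t) < \<Theta> s x \<omega> \<longleftrightarrow> ereal t < \<Theta> 0 x (\<theta> s \<omega>)" for t
      unfolding True by (cases "\<Theta> 0 x (\<theta> s \<omega>)"; simp add: add.commute)+
    have "flow_ext s (s + t) x \<omega> = \<phi> s (s + t) x \<omega>" "flow_ext 0 t x (\<theta> s \<omega>) = \<phi> 0 t x (\<theta> s \<omega>)"
      if "0 \<le> t" "ereal t < \<Theta> 0 x (\<theta> s \<omega>)" for t
      using that assms by (auto intro!: flow_ext_eq simp: *)
    then show ?thesis
      using assms True[symmetric] by (auto simp: disagree_at_def * max_def)
  qed
  then show ?thesis
    unfolding agree_def by blast
qed

lemma measurable_disagree_at:
  "Measurable.pred (borel \<Otimes>\<^sub>M borel \<Otimes>\<^sub>M M) disagree_at"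
proof -
  have "Measurable.pred ((borel \<Otimes>\<^sub>M borel) \<Otimes>\<^sub>M (borel \<Otimes>\<^sub>M M)) disagree_at"
    unfolding disagree_at_def case_prod_beta by measurable
  then show ?thesis
    by (simp add: borel_prod)
qed

lemma ae_agree: "AE \<omega> in M. AE s in lborel. 0 \<le> s \<longrightarrow> agree s \<omega>"
proof -
  \<comment> \<open>a probability measure equivalent to Lebesgue measure, as the projection theorem needs a finite one\<close>
  define \<nu> where "\<nu> = density lborel (\<lambda>s. ennreal (normal_density 0 1 s))"
  interpret \<nu>: prob_space \<nu>
    unfolding \<nu>_def by (rule prob_space_normal_density) simp
  interpret P: pair_prob_space \<nu> M ..
  have sets_\<nu> [measurable_cong]: "sets \<nu> = sets borel"
    by (simp add: \<nu>_def)
  let ?B = "{z \<in> space (borel \<Otimes>\<^sub>M \<nu> \<Otimes>\<^sub>M M). disagree_at z}"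
  have B: "?B \<in> sets (borel \<Otimes>\<^sub>M \<nu> \<Otimes>\<^sub>M M)"
    using measurable_disagree_at by measurable
  have "snd ` ?B \<in> sets (completion (\<nu> \<Otimes>\<^sub>M M))"
    by (rule P.measurable_projection[OF B])
  moreover have snd_B: "snd ` ?B = {(s, \<omega>). \<omega> \<in> space M \<and> 0 \<le> s \<and> \<not> agree s \<omega>}"
  proof (intro equalityI subsetI)
    fix z assume "z \<in> snd ` ?B"
    then show "z \<in> {(s, \<omega>). \<omega> \<in> space M \<and> 0 \<le> s \<and> \<not> agree s \<omega>}"
      using agree_iff by (fastforce simp: space_pair_measure disagree_at_def)
  next
    fix z assume "z \<in> {(s, \<omega>). \<omega> \<in> space M \<and> 0 \<le> s \<and> \<not> agree s \<omega>}"
    then obtain s \<omega> t x where "z = (s, \<omega>)" "\<omega> \<in> space M" "disagree_at ((t, x), (s, \<omega>))"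
      using agree_iff by auto
    then have "((t, x), z) \<in> ?B"
      by (simp add: space_pair_measure sets_eq_imp_space_eq[OF sets_\<nu>])
    then show "z \<in> snd ` ?B"
      by (metis (no_types, lifting) image_eqI snd_conv)
  qed
  moreover have "\<exists>N\<in>null_sets M. Pair s -` snd ` ?B \<subseteq> N" for s
  proof (cases "0 \<le> s")
    case True
    then show ?thesis
      using crude[OF True] unfolding snd_B agree_def by blast
  next
    case False
    then show ?thesis
      unfolding snd_B by (intro bexI[of _ "{}"]) auto
  qed
  \<comment> \<open>The projection is measurable for the completion only. Interchanging the two
    quantifiers needs a measurable exceptional set, so a null cover \<open>N\<close> takes its
    place.\<close>
  ultimately have "\<exists>N\<in>null_sets (\<nu> \<Otimes>\<^sub>M M). snd ` ?B \<subseteq> N"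
    by (intro null_sections_imp_null)
  then obtain N where N: "N \<in> null_sets (\<nu> \<Otimes>\<^sub>M M)" "snd ` ?B \<subseteq> N"
    by blast
  have N_sets [measurable]: "N \<in> sets (\<nu> \<Otimes>\<^sub>M M)"
    using N(1) by auto
  have "AE z in \<nu> \<Otimes>\<^sub>M M. z \<notin> N"
    using N(1) by (rule AE_not_in)
  then have "AE s in \<nu>. AE \<omega> in M. (s, \<omega>) \<notin> N"
    by (rule P.AE_pair)
  moreover have "{z \<in> space (\<nu> \<Otimes>\<^sub>M M). (fst z, snd z) \<notin> N} \<in> sets (\<nu> \<Otimes>\<^sub>M M)"
    by measurable
  ultimately have "AE \<omega> in M. AE s in \<nu>. (s, \<omega>) \<notin> N"
    using P.AE_commute[of "\<lambda>s \<omega>. (s, \<omega>) \<notin> N"] by simp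
  then show ?thesis
  proof (rule AE_mp[OF _ AE_I2[OF impI]])
    fix \<omega> assume \<omega>: "\<omega> \<in> space M" "AE s in \<nu>. (s, \<omega>) \<notin> N"
    \<comment> \<open>The normal density is positive everywhere, so null sets of
      \<open>\<nu>\<close> are Lebesgue null.\<close>
    then have "AE s in lborel. (s, \<omega>) \<notin> N"
      unfolding \<nu>_def by (subst (asm) AE_density) (simp_all add: normal_density_pos)
    then show "AE s in lborel. 0 \<le> s \<longrightarrow> agree s \<omega>"
    proof eventually_elim
      case (elim s)
      then show ?case
        using N(2) \<omega>(1) unfolding snd_B by blast
    qed
  qed
qed

section \<open>The good event and the shift-invariant regular event\<close>

definition good_set :: "'w set" where
  "good_set = (SOME G. G \<in> sets M \<and> (AE \<omega> in M. \<omega> \<in> G) \<and>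
    (\<forall>\<omega>\<in>G. AE s in lborel. 0 \<le> s \<longrightarrow> agree s \<omega>))"

text \<open>As \<open>M\<close> is not assumed complete, the set of all \<open>\<omega>\<close> with
  this property need not be measurable; the complement of a null set that covers the exceptions
  serves as witness.\<close>

lemma good_set: "good_set \<in> sets M" "AE \<omega> in M. \<omega> \<in> good_set"
  and good_set_agree: "\<omega> \<in> good_set \<Longrightarrow> AE s in lborel. 0 \<le> s \<longrightarrow> agree s \<omega>"
proof -
  obtain N where N: "N \<in> null_sets M"
      "{\<omega> \<in> space M. \<not> (AE s in lborel. 0 \<le> s \<longrightarrow> agree s \<omega>)} \<subseteq> N"
    using ae_agree unfolding eventually_ae_filter by blast
  have "\<exists>G. G \<in> sets M \<and> (AE \<omega> in M. \<omega> \<in> G) \<and>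
    (\<forall>\<omega>\<in>G. AE s in lborel. 0 \<le> s \<longrightarrow> agree s \<omega>)"
  proof (intro exI[of _ "space M - N"] conjI ballI)
    show "space M - N \<in> sets M"
      using N(1) by auto
    show "AE \<omega> in M. \<omega> \<in> space M - N"
      using AE_not_in[OF N(1)] AE_space by eventually_elim simp
    show "AE s in lborel. 0 \<le> s \<longrightarrow> agree s \<omega>" if "\<omega> \<in> space M - N" for \<omega>
      using that N(2) by blast
  qed
  from someI_ex[OF this] show "good_set \<in> sets M" "AE \<omega> in M. \<omega> \<in> good_set"
      "\<omega> \<in> good_set \<Longrightarrow> AE s in lborel. 0 \<le> s \<longrightarrow> agree s \<omega>"
    unfolding good_set_def by blast+
qed

lemma good_set_space: "\<omega> \<in> good_set \<Longrightarrow> \<omega> \<in> space M"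
  using good_set(1) sets.sets_into_space by blast

text \<open>Quantifying over all real \<open>r\<close>, not only \<open>r \<ge> 0\<close>, makes this property shift invariant.\<close>

definition regular :: "'w \<Rightarrow> bool" where
  "regular \<omega> \<longleftrightarrow> (AE r in lborel. \<theta> (- r) \<omega> \<in> good_set)"

lemma measurable_good_set [measurable]: "Measurable.pred M (\<lambda>\<omega>. \<omega> \<in> good_set)"
  using good_set(1) by measurable

lemma measurable_regular [measurable]: "Measurable.pred M regular"
  unfolding regular_def by (intro lborel.pred_AE) measurable

lemma AE_regular: "AE \<omega> in M. regular \<omega>"
proof -
  interpret P: pair_sigma_finite lborel M ..
  have "AE r in lborel. AE \<omega> in M. \<theta> (- r) \<omega> \<in> good_set"
    by (intro AE_I2 AE_shift good_set)
  moreover have "{z \<in> space (lborel \<Otimes>\<^sub>M M). \<theta> (- fst z) (snd z) \<in> good_set} \<in> sets (lborel \<Otimes>\<^sub>M M)"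
    by measurable
  ultimately show ?thesis
    unfolding regular_def using P.AE_commute[of "\<lambda>r \<omega>. \<theta> (- r) \<omega> \<in> good_set"] by simp
qed

lemma shift_shift: "\<omega> \<in> space M \<Longrightarrow> \<theta> t (\<theta> s \<omega>) = \<theta> (t + s) \<omega>"
  by (simp add: shift_add)

text \<open>Since \<open>\<theta> (- r) (\<theta> s \<omega>) = \<theta> (s - r) \<omega>\<close>, a
  shift of the noise reflects as a translation of \<open>r\<close>, which preserves Lebesgue null
  sets. The converse is the same implication for \<open>- s\<close>.\<close>

lemma regular_shift:
  assumes \<omega>: "\<omega> \<in> space M"
  shows "regular (\<theta> s \<omega>) \<longleftrightarrow> regular \<omega>"
proof -
  have *: "regular (\<theta> s \<omega>)" if \<omega>: "\<omega> \<in> space M" and "regular \<omega>" for s \<omega>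
  proof -
    have "AE r in lborel. \<theta> (- (- s + r)) \<omega> \<in> good_set"
      using \<open>regular \<omega>\<close> unfolding regular_def by (rule AE_lborel_shift)
    then show ?thesis
      unfolding regular_def using \<omega> by (simp add: shift_shift)
  qed
  from *[of \<omega> s] *[of "\<theta> s \<omega>" "- s"] \<omega> show ?thesis
    by (auto simp: shift_shift shift_zero)
qed

lemma regular_start:
  assumes "regular \<omega>"
  shows "\<exists>r. 0 \<le> r \<and> \<theta> (- r) \<omega> \<in> good_set"
  using AE_lborel_obtain[OF assms[unfolded regular_def], of 0 1] by (auto intro: less_imp_le)

section \<open>Independence of the starting time\<close>

lemma common_shift:
  assumes good: "\<omega>1 \<in> good_set" "\<omega>2 \<in> good_set" and r: "0 \<le> r1" "0 \<le> r2"
  shows "AE u in lborel. 0 < u \<longrightarrow> agree (r1 + u) \<omega>1 \<and> agree (r2 + u) \<omega>2"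
  using AE_lborel_shift[OF good_set_agree[OF good(1)], of r1]
    AE_lborel_shift[OF good_set_agree[OF good(2)], of r2]
  by eventually_elim (use r in auto)

text \<open>A property of almost every \<open>u\<close> holds somewhere in each interval
  \<open>(0, b)\<close>, so both agreements can be combined with any property of all small
  \<open>u > 0\<close>.\<close>

lemma ex_common_shift:
  assumes good: "\<omega>1 \<in> good_set" "\<omega>2 \<in> good_set" and r: "0 \<le> r1" "0 \<le> r2"
    and P: "\<forall>\<^sub>F u in at_right 0. P u"
  shows "\<exists>u>0. P u \<and> agree (r1 + u) \<omega>1 \<and> agree (r2 + u) \<omega>2"
proof -
  obtain b :: real where b: "0 < b" "\<And>u. 0 < u \<Longrightarrow> u < b \<Longrightarrow> P u"
    using P unfolding eventually_at_right_field by auto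
  show ?thesis
    using AE_lborel_obtain[OF common_shift[OF good r] b(1)] b(2) by blast
qed

lemma agreeD:
  assumes "agree s \<omega>"
  shows "ereal (s + t) < \<Theta> s x \<omega> \<longleftrightarrow> ereal t < \<Theta> 0 x (\<theta> s \<omega>)"
    and "0 \<le> t \<Longrightarrow> ereal (s + t) < \<Theta> s x \<omega> \<Longrightarrow> \<phi> s (s + t) x \<omega> = \<phi> 0 t x (\<theta> s \<omega>)"
proof -
  have *: "\<Theta> s x \<omega> = \<Theta> 0 x (\<theta> s \<omega>) + ereal s"
    using assms by (simp add: agree_def)
  show "ereal (s + t) < \<Theta> s x \<omega> \<longleftrightarrow> ereal t < \<Theta> 0 x (\<theta> s \<omega>)"
    unfolding * by (cases "\<Theta> 0 x (\<theta> s \<omega>)") (auto simp: add.commute)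
  assume "0 \<le> t" "ereal (s + t) < \<Theta> s x \<omega>"
  moreover from this(2) have "ereal t < \<Theta> s x \<omega> - ereal s"
    by (cases "\<Theta> s x \<omega>") auto
  ultimately show "\<phi> s (s + t) x \<omega> = \<phi> 0 t x (\<theta> s \<omega>)"
    using assms by (simp add: agree_def)
qed

lemma lifetime_right:
  assumes "\<omega> \<in> space M" "0 \<le> r" "a < \<Theta> r x \<omega>"
  shows "\<forall>\<^sub>F u in at_right 0. a < \<Theta> (r + u) x \<omega>"
  using lower_semicontinuous_on_right[OF lifetime_lsc[OF assms(1)] assms(2), of a x] assms(3) by simp

text \<open>
  For almost every small \<open>u > 0\<close> both flows, started at time \<open>u\<close> later, coincide with the flow at the
  common base point; then \<open>u\<close> tends to \<open>0\<close> by right continuity in the starting time.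
\<close>

lemma flow_start_independent:
  assumes good: "\<omega>1 \<in> good_set" "\<omega>2 \<in> good_set" and r: "0 \<le> r1" "0 \<le> r2"
    and eq: "\<theta> r1 \<omega>1 = \<theta> r2 \<omega>2"
    and T: "0 \<le> T" "ereal (r1 + T) < \<Theta> r1 x \<omega>1" "ereal (r2 + T) < \<Theta> r2 x \<omega>2"
  shows "\<phi> r1 (r1 + T) x \<omega>1 = \<phi> r2 (r2 + T) x \<omega>2"
proof (cases "T = 0")
  case True
  then show ?thesis
    using flow_id good good_set_space r by simp
next
  case False
  with T have "0 < T" by simp
  \<comment> \<open>The end time stays fixed while the start moves. \<open>0 < T\<close> puts the
    start strictly before it, as \<open>flow_right_cont_start\<close> requires.\<close>
  have lim: "((\<lambda>u. \<phi> (r + u) (r + T) x \<omega>) \<longlongrightarrow> \<phi> r (r + T) x \<omega>) (at_right 0)"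
    if "\<omega> \<in> good_set" "0 \<le> r" "ereal (r + T) < \<Theta> r x \<omega>" for r \<omega>
    using flow_right_cont_start[of \<omega> r "r + T" x] that good_set_space \<open>0 < T\<close>
    by (simp add: continuous_within filterlim_at_right_to_0[of _ _ r] add.commute)
  have sp: "\<omega>1 \<in> space M" "\<omega>2 \<in> space M"
    using good good_set_space by auto
  let ?d = "\<lambda>u. dist (\<phi> (r1 + u) (r1 + T) x \<omega>1) (\<phi> (r2 + u) (r2 + T) x \<omega>2)"
  have dlim: "(?d \<longlongrightarrow> dist (\<phi> r1 (r1 + T) x \<omega>1) (\<phi> r2 (r2 + T) x \<omega>2)) (at_right 0)"
    using good r T by (intro tendsto_dist lim)
  show ?thesis
  proof (rule ccontr)
    \<comment> \<open>Agreement is known for almost every \<open>u\<close> only. A positive distance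
      would persist for all small \<open>u\<close>, and a single \<open>u\<close> with both
      agreements refutes it.\<close>
    assume "\<not> ?thesis"
    then have "\<forall>\<^sub>F u in at_right 0. 0 < ?d u"
      by (intro order_tendstoD(1)[OF dlim]) simp
    moreover have "\<forall>\<^sub>F u in at_right 0. ereal (r1 + T) < \<Theta> (r1 + u) x \<omega>1"
      using sp r T by (intro lifetime_right)
    moreover have "\<forall>\<^sub>F u in at_right 0. ereal (r2 + T) < \<Theta> (r2 + u) x \<omega>2"
      using sp r T by (intro lifetime_right)
    moreover have "\<forall>\<^sub>F u in at_right 0. u < T"
      using eventually_at_right_real[OF \<open>0 < T\<close>] by (rule eventually_mono) simp
    ultimately have "\<forall>\<^sub>F u in at_right 0. 0 < ?d u \<and> ereal (r1 + T) < \<Theta> (r1 + u) x \<omega>1 \<and>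
        ereal (r2 + T) < \<Theta> (r2 + u) x \<omega>2 \<and> u < T"
      by eventually_elim simp
    from ex_common_shift[OF good r this] obtain u where u: "0 < u" "0 < ?d u"
      "ereal (r1 + T) < \<Theta> (r1 + u) x \<omega>1" "ereal (r2 + T) < \<Theta> (r2 + u) x \<omega>2" "u < T"
      "agree (r1 + u) \<omega>1" "agree (r2 + u) \<omega>2"
      by blast
    have "\<phi> (r + u) (r + T) x \<omega> = \<phi> 0 (T - u) x (\<theta> (r + u) \<omega>)"
      if "agree (r + u) \<omega>" "ereal (r + T) < \<Theta> (r + u) x \<omega>" for r \<omega>
      using agreeD(2)[OF that(1), of "T - u" x] that(2) u by simp
    then have "?d u = dist (\<phi> 0 (T - u) x (\<theta> (r1 + u) \<omega>1)) (\<phi> 0 (T - u) x (\<theta> (r2 + u) \<omega>2))"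
      using u by simp
    also have "\<theta> (r1 + u) \<omega>1 = \<theta> (r2 + u) \<omega>2"
      using eq sp shift_add[of _ u] by (simp add: add.commute)
    finally show False
      using u by simp
  qed
qed

text \<open>
  Lower semicontinuity alone does not let \<open>u \<rightarrow> 0\<close> in the lifetimes. Instead the point \<open>x\<close> is first
  moved for a short time \<open>u\<close>, which does not change the explosion time.
\<close>

lemma lifetime_start_independent_imp:
  assumes good: "\<omega>1 \<in> good_set" "\<omega>2 \<in> good_set" and r: "0 \<le> r1" "0 \<le> r2"
    and eq: "\<theta> r1 \<omega>1 = \<theta> r2 \<omega>2"
    and T: "0 < T" "ereal (r1 + T) < \<Theta> r1 x \<omega>1"
  shows "ereal (r2 + T) < \<Theta> r2 x \<omega>2"
proof -
  have sp: "\<omega>1 \<in> space M" "\<omega>2 \<in> space M"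
    using good good_set_space by auto
  have ev: "\<forall>\<^sub>F u in at_right 0. ereal (r + u) < \<Theta> r x \<omega>" if "\<omega> \<in> space M" "0 \<le> r" for r \<omega>
  proof -
    have "((\<lambda>u. ereal (r + u)) \<longlongrightarrow> ereal (r + 0)) (at_right 0)"
      by (intro tendsto_intros)
    then show ?thesis
      using flow_id[OF that] by (intro order_tendstoD(2)) auto
  qed
  have "\<forall>\<^sub>F u in at_right 0. ereal (r1 + u) < \<Theta> r1 x \<omega>1 \<and> ereal (r2 + u) < \<Theta> r2 x \<omega>2 \<and> u < T"
    using ev[OF sp(1) r(1)] ev[OF sp(2) r(2)] eventually_at_right_real[OF T(1)]
    by eventually_elim simp
  from ex_common_shift[OF good r this] obtain u where u: "0 < u" "u < T"
    "ereal (r1 + u) < \<Theta> r1 x \<omega>1" "ereal (r2 + u) < \<Theta> r2 x \<omega>2"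
    "agree (r1 + u) \<omega>1" "agree (r2 + u) \<omega>2"
    by blast
  define y where "y = \<phi> r1 (r1 + u) x \<omega>1"
  \<comment> \<open>Flow independence with \<open>T = u\<close> gives one point for both noises, so
    the common base point decides both survival questions.\<close>
  have y: "y = \<phi> r2 (r2 + u) x \<omega>2"
    unfolding y_def using good r eq u by (intro flow_start_independent) auto
  have "ereal (r1 + T) < \<Theta> (r1 + u) y \<omega>1"
    using lifetime_flow[of \<omega>1 r1 "r1 + u" x] T u r sp by (simp add: y_def)
  then have "ereal (T - u) < \<Theta> 0 y (\<theta> (r1 + u) \<omega>1)"
    using agreeD(1)[OF u(5), of "T - u" y] by simp
  moreover have "\<theta> (r1 + u) \<omega>1 = \<theta> (r2 + u) \<omega>2"
    using eq sp shift_add[of _ u] by (simp add: add.commute)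
  ultimately have "ereal (r2 + T) < \<Theta> (r2 + u) y \<omega>2"
    using agreeD(1)[OF u(6), of "T - u" y] by simp
  then show ?thesis
    using lifetime_flow[of \<omega>2 r2 "r2 + u" x] u r sp by (simp add: y)
qed

lemma lifetime_start_independent:
  assumes "\<omega>1 \<in> good_set" "\<omega>2 \<in> good_set" "0 \<le> r1" "0 \<le> r2" "\<theta> r1 \<omega>1 = \<theta> r2 \<omega>2"
  shows "\<Theta> r1 x \<omega>1 - ereal r1 = \<Theta> r2 x \<omega>2 - ereal r2"
proof (rule ereal_minus_eqI)
  show "ereal r1 < \<Theta> r1 x \<omega>1" "ereal r2 < \<Theta> r2 x \<omega>2"
    using flow_id assms good_set_space by auto
  show "ereal (r1 + T) < \<Theta> r1 x \<omega>1 \<longleftrightarrow> ereal (r2 + T) < \<Theta> r2 x \<omega>2" if "0 < T" for T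
    using lifetime_start_independent_imp[OF assms that]
      lifetime_start_independent_imp[OF assms(2,1,4,3) assms(5)[symmetric] that] by blast
qed

section \<open>Construction and measurability of the perfect version\<close>

definition start :: "'w \<Rightarrow> real" where
  "start \<omega> = (SOME r. 0 \<le> r \<and> \<theta> (- r) \<omega> \<in> good_set)"

text \<open>The subtraction turns an absolute explosion time into a remaining one. Off the regular
  event, infinite lifetime and identity flow also respect continuity and globality, and shift
  invariance of \<open>regular\<close> keeps the two cases apart.\<close>

definition perfect_lifetime :: "'a \<Rightarrow> 'w \<Rightarrow> ereal" where
  "perfect_lifetime x \<omega> = (if regular \<omega>
    then \<Theta> (start \<omega>) x (\<theta> (- start \<omega>) \<omega>) - ereal (start \<omega>) else \<infinity>)"

definition perfect_flow :: "real \<Rightarrow> 'a \<Rightarrow> 'w \<Rightarrow> 'a" where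
  "perfect_flow t x \<omega> = (if regular \<omega>
    then \<phi> (start \<omega>) (start \<omega> + t) x (\<theta> (- start \<omega>) \<omega>) else x)"

lemma start: "regular \<omega> \<Longrightarrow> 0 \<le> start \<omega>" "regular \<omega> \<Longrightarrow> \<theta> (- start \<omega>) \<omega> \<in> good_set"
  using someI_ex[OF regular_start] by (auto simp: start_def)

lemma perfect_lifetime_eq:
  assumes "\<omega> \<in> space M" "regular \<omega>" "0 \<le> r" "\<theta> (- r) \<omega> \<in> good_set"
  shows "perfect_lifetime x \<omega> = \<Theta> r x (\<theta> (- r) \<omega>) - ereal r"
  using assms(2) lifetime_start_independent[OF start(2) assms(4) start(1) assms(3), OF assms(2,2)]
    shift_shift[OF assms(1)] by (simp add: perfect_lifetime_def)

lemma less_perfect_lifetime_iff: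
  assumes "\<omega> \<in> space M" "regular \<omega>" "0 \<le> r" "\<theta> (- r) \<omega> \<in> good_set"
  shows "ereal t < perfect_lifetime x \<omega> \<longleftrightarrow> ereal (r + t) < \<Theta> r x (\<theta> (- r) \<omega>)"
  unfolding perfect_lifetime_eq[OF assms]
  by (cases "\<Theta> r x (\<theta> (- r) \<omega>)") auto

lemma perfect_flow_eq:
  assumes "\<omega> \<in> space M" "regular \<omega>" "0 \<le> r" "\<theta> (- r) \<omega> \<in> good_set"
    and "0 \<le> t" "ereal t < perfect_lifetime x \<omega>"
  shows "perfect_flow t x \<omega> = \<phi> r (r + t) x (\<theta> (- r) \<omega>)"
proof -
  note less = less_perfect_lifetime_iff[OF assms(1,2)]
  have "\<phi> (start \<omega>) (start \<omega> + t) x (\<theta> (- start \<omega>) \<omega>) = \<phi> r (r + t) x (\<theta> (- r) \<omega>)"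
  proof (rule flow_start_independent[OF start(2) assms(4) start(1) assms(3), OF assms(2,2)])
    show "\<theta> (start \<omega>) (\<theta> (- start \<omega>) \<omega>) = \<theta> r (\<theta> (- r) \<omega>)"
      by (simp add: shift_shift[OF assms(1)])
    show "ereal (start \<omega> + t) < \<Theta> (start \<omega>) x (\<theta> (- start \<omega>) \<omega>)"
      using less[OF start[OF assms(2)]] assms(6) by simp
    show "ereal (r + t) < \<Theta> r x (\<theta> (- r) \<omega>)"
      using less[OF assms(3,4)] assms(6) by simp
  qed fact
  with assms(2) show ?thesis
    by (simp add: perfect_flow_def)
qed

lemma not_regular:
  assumes "\<not> regular \<omega>"
  shows "perfect_lifetime x \<omega> = \<infinity>" "perfect_flow t x \<omega> = x"
  using assms by (simp_all add: perfect_lifetime_def perfect_flow_def)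

lemma ereal_less_perfect_lifetime_iff:
  assumes "\<omega> \<in> space M" "regular \<omega>" "0 \<le> r" "\<theta> (- r) \<omega> \<in> good_set"
  shows "a < perfect_lifetime x \<omega> \<longleftrightarrow> a + ereal r < \<Theta> r x (\<theta> (- r) \<omega>)"
  unfolding perfect_lifetime_eq[OF assms] by (simp add: ereal_less_minus)

text \<open>
  The choice made by \<open>start\<close> need not be measurable; but almost every \<open>r \<ge> 0\<close> gives the same value, and
  quantification over almost every \<open>r\<close> preserves measurability.
\<close>

lemma measurable_perfect_lifetime:
  "(\<lambda>(x, \<omega>). perfect_lifetime x \<omega>) \<in> borel_measurable (borel \<Otimes>\<^sub>M M)"
proof (rule borel_measurableI_greater)
  fix a :: ereal
  let ?Q = "\<lambda>z. if regular (snd z)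
    then AE r in lborel. 0 \<le> r \<longrightarrow> a + ereal r < \<Theta> (max 0 r) (fst z) (\<theta> (- r) (snd z))
    else a < \<infinity>"
  have "Measurable.pred (borel \<Otimes>\<^sub>M M) (\<lambda>z. AE r in lborel. 0 \<le> r \<longrightarrow>
      a + ereal r < \<Theta> (max 0 r) (fst z) (\<theta> (- r) (snd z)))"
    by (rule lborel.pred_AE) (unfold case_prod_beta, measurable)
  then have "{z \<in> space (borel \<Otimes>\<^sub>M M). ?Q z} \<in> sets (borel \<Otimes>\<^sub>M M)"
    by measurable
  also have "{z \<in> space (borel \<Otimes>\<^sub>M M). ?Q z} =
      {z \<in> space (borel \<Otimes>\<^sub>M M). a < (case z of (x, \<omega>) \<Rightarrow> perfect_lifetime x \<omega>)}"
  proof (rule Collect_cong, rule conj_cong[OF refl])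
    fix z :: "'a \<times> 'w" assume z: "z \<in> space (borel \<Otimes>\<^sub>M M)"
    obtain x \<omega> where [simp]: "z = (x, \<omega>)"
      by (cases z)
    have \<omega>: "\<omega> \<in> space M"
      using z by (simp add: space_pair_measure)
    show "?Q z \<longleftrightarrow> a < (case z of (x, \<omega>) \<Rightarrow> perfect_lifetime x \<omega>)"
    proof (cases "regular \<omega>")
      case True
      have "AE r in lborel. 0 \<le> r \<longrightarrow>
          (a + ereal r < \<Theta> (max 0 r) x (\<theta> (- r) \<omega>) \<longleftrightarrow> a < perfect_lifetime x \<omega>)"
        using True[unfolded regular_def]
      proof eventually_elim
        case (elim r)
        then show ?case
          using ereal_less_perfect_lifetime_iff[OF \<omega> True] by (simp add: max_def)
      qed
      from AE_nonneg_const_iff[OF this] True show ?thesis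
        by simp
    next
      case False
      then show ?thesis
        by (simp add: not_regular)
    qed
  qed
  finally show "{z \<in> space (borel \<Otimes>\<^sub>M M). a < (case z of (x, \<omega>) \<Rightarrow> perfect_lifetime x \<omega>)}
      \<in> sets (borel \<Otimes>\<^sub>M M)" .
qed

text \<open>As for the lifetime, almost every \<open>r \<ge> 0\<close> decides whether the value
  lies in the open set \<open>U\<close>, now with \<open>flow_ext\<close> as the measurable
  integrand. The condition \<open>?Q\<close> describes the preimage only on \<open>?D\<close>, which
  is what the trace \<sigma>-field asks for.\<close>

lemma measurable_perfect_flow:
  "(\<lambda>(t, x, \<omega>). perfect_flow t x \<omega>) \<in> measurable
    (restrict_space (borel \<Otimes>\<^sub>M borel \<Otimes>\<^sub>M M)
      {(t, x, \<omega>). 0 \<le> t \<and> ereal t < perfect_lifetime x \<omega> \<and> \<omega> \<in> space M}) borel"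
proof (rule borel_measurableI)
  fix U :: "'a set" assume "open U"
  then have [measurable]: "U \<in> sets borel"
    by simp
  let ?L = "borel \<Otimes>\<^sub>M borel \<Otimes>\<^sub>M M :: (real \<times> 'a \<times> 'w) measure"
  let ?D = "{(t, x, \<omega>). 0 \<le> t \<and> ereal t < perfect_lifetime x \<omega> \<and> \<omega> \<in> space M}"
  let ?f = "\<lambda>(t, x, \<omega>). perfect_flow t x \<omega>"
  let ?Q = "\<lambda>z. if regular (snd (snd z))
    then AE r in lborel. 0 \<le> r \<longrightarrow>
      flow_ext r (r + fst z) (fst (snd z)) (\<theta> (- r) (snd (snd z))) \<in> U
    else fst (snd z) \<in> U"
  have "Measurable.pred ?L (\<lambda>z. AE r in lborel. 0 \<le> r \<longrightarrow>
      flow_ext r (r + fst z) (fst (snd z)) (\<theta> (- r) (snd (snd z))) \<in> U)"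
    by (rule lborel.pred_AE) (unfold case_prod_beta, measurable)
  then have Q: "{z \<in> space ?L. ?Q z} \<in> sets ?L"
    by measurable
  have Q_iff: "?Q z \<longleftrightarrow> ?f z \<in> U" if z: "z \<in> ?D" for z
  proof -
    obtain t x \<omega> where [simp]: "z = (t, x, \<omega>)"
      by (cases z) auto
    have \<omega>: "\<omega> \<in> space M" and t: "0 \<le> t" "ereal t < perfect_lifetime x \<omega>"
      using z by auto
    show ?thesis
    proof (cases "regular \<omega>")
      case True
      have "AE r in lborel. 0 \<le> r \<longrightarrow>
          (flow_ext r (r + t) x (\<theta> (- r) \<omega>) \<in> U \<longleftrightarrow> perfect_flow t x \<omega> \<in> U)"
        using True[unfolded regular_def]
      proof eventually_elim
        case (elim r)
        show ?case
        proof
          assume r: "0 \<le> r"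
          have "ereal (r + t) < \<Theta> r x (\<theta> (- r) \<omega>)"
            using less_perfect_lifetime_iff[OF \<omega> True r elim] t(2) by blast
          then show "flow_ext r (r + t) x (\<theta> (- r) \<omega>) \<in> U \<longleftrightarrow> perfect_flow t x \<omega> \<in> U"
            using perfect_flow_eq[OF \<omega> True r elim t] t(1) r by (simp add: flow_ext_eq)
        qed
      qed
      from AE_nonneg_const_iff[OF this] True show ?thesis
        by simp
    next
      case False
      then show ?thesis
        by (simp add: not_regular)
    qed
  qed
  have "?f -` U \<inter> space (restrict_space ?L ?D) = ?D \<inter> {z \<in> space ?L. ?Q z}"
  proof (intro set_eqI iffI)
    fix z assume "z \<in> ?f -` U \<inter> space (restrict_space ?L ?D)"
    then have "?f z \<in> U" "z \<in> ?D" "z \<in> space ?L"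
      unfolding space_restrict_space by blast+
    with Q_iff show "z \<in> ?D \<inter> {z \<in> space ?L. ?Q z}"
      by blast
  next
    fix z assume "z \<in> ?D \<inter> {z \<in> space ?L. ?Q z}"
    then have "?Q z" "z \<in> ?D" "z \<in> space ?L"
      by blast+
    with Q_iff show "z \<in> ?f -` U \<inter> space (restrict_space ?L ?D)"
      unfolding space_restrict_space by blast
  qed
  with Q show "?f -` U \<inter> space (restrict_space ?L ?D) \<in> sets (restrict_space ?L ?D)"
    unfolding sets_restrict_space by (metis (no_types, lifting) image_eqI)
qed

lemma perfect_start_eqs:
  assumes "\<omega> \<in> space M" "regular \<omega>"
  shows "perfect_lifetime x \<omega> = \<Theta> (start \<omega>) x (\<theta> (- start \<omega>) \<omega>) - ereal (start \<omega>)"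
    and "ereal t < perfect_lifetime x \<omega> \<longleftrightarrow> ereal (start \<omega> + t) < \<Theta> (start \<omega>) x (\<theta> (- start \<omega>) \<omega>)"
    and "perfect_flow t x \<omega> = \<phi> (start \<omega>) (start \<omega> + t) x (\<theta> (- start \<omega>) \<omega>)"
  using assms less_perfect_lifetime_iff[OF assms start[OF assms(2)]]
  by (simp_all add: perfect_lifetime_def perfect_flow_def)

lemma perfect_cocycle:
  assumes \<omega>: "\<omega> \<in> space M" and s: "0 \<le> s" "ereal s < perfect_lifetime x \<omega>"
  shows "perfect_lifetime (perfect_flow s x \<omega>) (\<theta> s \<omega>) + ereal s = perfect_lifetime x \<omega> \<and>
    (\<forall>t. 0 \<le> t \<longrightarrow> ereal (t + s) < perfect_lifetime x \<omega> \<longrightarrow>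
      perfect_flow (t + s) x \<omega> = perfect_flow t (perfect_flow s x \<omega>) (\<theta> s \<omega>))"
proof (cases "regular \<omega>")
  case True
  note eqs = perfect_start_eqs[OF \<omega>]
  have start_space: "\<theta> (- start \<omega>) \<omega> \<in> space M"
    using \<omega> by simp
  define r \<omega>' where "r = start \<omega>" and "\<omega>' = \<theta> (- r) \<omega>"
  have r: "0 \<le> r" "\<omega>' \<in> good_set" "\<omega>' \<in> space M"
    using start[OF True] start_space by (simp_all add: r_def \<omega>'_def)
  have shifted: "\<theta> s \<omega> \<in> space M" "regular (\<theta> s \<omega>)" "0 \<le> r + s" "\<theta> (- (r + s)) (\<theta> s \<omega>) = \<omega>'"
    using \<omega> True regular_shift s r by (simp_all add: shift_shift \<omega>'_def)
  define y where "y = \<phi> r (r + s) x \<omega>'"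
  have y: "perfect_flow s x \<omega> = y"
    by (simp add: eqs[OF True] y_def r_def \<omega>'_def)
  have less: "ereal (r + s) < \<Theta> r x \<omega>'"
    using s(2) eqs(2)[OF True] by (simp add: r_def \<omega>'_def)
  have life_y: "\<Theta> (r + s) y \<omega>' = \<Theta> r x \<omega>'"
    unfolding y_def using r s less by (intro lifetime_flow) auto
  note good' = r(2)[folded shifted(4)]
  have life: "perfect_lifetime y (\<theta> s \<omega>) = \<Theta> r x \<omega>' - ereal (r + s)"
    using perfect_lifetime_eq[OF shifted(1-3) good'] life_y shifted(4) by simp
  have "perfect_lifetime x \<omega> = \<Theta> r x \<omega>' - ereal r"
    using eqs(1)[OF True] by (simp add: r_def \<omega>'_def)
  then have "perfect_lifetime y (\<theta> s \<omega>) + ereal s = perfect_lifetime x \<omega>"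
    unfolding life by (cases "\<Theta> r x \<omega>'") auto
  moreover have "perfect_flow (t + s) x \<omega> = perfect_flow t y (\<theta> s \<omega>)"
    if t: "0 \<le> t" "ereal (t + s) < perfect_lifetime x \<omega>" for t
  proof -
    have less_t: "ereal (r + s + t) < \<Theta> r x \<omega>'"
      using t(2) eqs(2)[OF True] by (simp add: r_def \<omega>'_def ac_simps)
    have "perfect_flow t y (\<theta> s \<omega>) = \<phi> (r + s) (r + s + t) y \<omega>'"
      using perfect_flow_eq[OF shifted(1-3) good' t(1)]
        less_perfect_lifetime_iff[OF shifted(1-3) good'] less_t life_y shifted(4)
      by (simp add: ac_simps)
    also have "\<dots> = \<phi> r (r + s + t) x \<omega>'"
    \<comment> \<open>\<open>flow_compose\<close> requires a strictly later end time, so zero time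
      is left to \<open>flow_id\<close>.\<close>
    proof (cases "t = 0")
      case True
      then show ?thesis
        using flow_id r s by (simp add: y_def)
    next
      case False
      then show ?thesis
        using flow_compose[of \<omega>' r "r + s" "r + s + t" x] r s t less_t by (simp add: y_def)
    qed
    also have "\<dots> = perfect_flow (t + s) x \<omega>"
      by (simp add: eqs[OF True] r_def \<omega>'_def ac_simps)
    finally show ?thesis ..
  qed
  ultimately show ?thesis
    using y by simp
next
  case False
  then show ?thesis
    using \<omega> by (simp add: not_regular regular_shift)
qed

section \<open>Verification of the random dynamical system properties\<close>

lemma local_rds_perfect: "local_rds M \<theta> perfect_flow perfect_lifetime"
proof unfold_locales
  fix \<omega> assume \<omega>: "\<omega> \<in> space M"
  have start_space: "\<theta> (- start \<omega>) \<omega> \<in> space M"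
    using \<omega> by simp
  note eqs = perfect_start_eqs[OF \<omega>]
  show "0 < perfect_lifetime x \<omega>" for x
  proof (cases "regular \<omega>")
    case True
    then show ?thesis
      using eqs(2)[OF True, of 0 x] flow_id[OF start_space start(1)[OF True], of x]
      by (simp add: zero_ereal_def)
  qed (simp add: not_regular)
  show "lower_semicontinuous_on UNIV (\<lambda>x. perfect_lifetime x \<omega>)"
    unfolding lower_semicontinuous_on_def
  proof
    fix a
    have "open {x. a < perfect_lifetime x \<omega>}"
    proof (cases "regular \<omega>")
      case True
      then show ?thesis
        using lower_semicontinuous_on_section[OF lifetime_lsc[OF start_space] start(1)[OF True],
            of "a + ereal (start \<omega>)"]
        by (simp add: ereal_less_perfect_lifetime_iff[OF \<omega> True start[OF True]])
    qed (simp add: not_regular)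
    then show "openin (top_of_set UNIV) {x \<in> UNIV. a < perfect_lifetime x \<omega>}"
      by simp
  qed
  show "perfect_flow 0 x \<omega> = x" for x
    using flow_id[OF start_space start(1)]
    by (cases "regular \<omega>") (simp_all add: eqs not_regular)
  show "continuous (at_right t) (\<lambda>r. perfect_flow r x \<omega>)"
    if t: "0 \<le> t" "ereal t < perfect_lifetime x \<omega>" for t x
  proof (cases "regular \<omega>")
    case True
    have "continuous (at_right (start \<omega> + t)) (\<lambda>r. \<phi> (start \<omega>) r x (\<theta> (- start \<omega>) \<omega>))"
      using t eqs(2)[OF True] start(1)[OF True] start_space by (intro flow_right_cont_end) auto
    then have "((\<lambda>u. \<phi> (start \<omega>) (u + (start \<omega> + t)) x (\<theta> (- start \<omega>) \<omega>)) \<longlongrightarrow>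
        \<phi> (start \<omega>) (start \<omega> + t) x (\<theta> (- start \<omega>) \<omega>)) (at_right 0)"
      unfolding continuous_within filterlim_at_right_to_0[of _ _ "start \<omega> + t"] .
    then have "((\<lambda>u. perfect_flow (u + t) x \<omega>) \<longlongrightarrow> perfect_flow t x \<omega>) (at_right 0)"
      by (simp add: eqs[OF True] ac_simps)
    then show ?thesis
      unfolding continuous_within filterlim_at_right_to_0[of _ _ t] .
  qed (simp add: not_regular)
  show "perfect_lifetime (perfect_flow s x \<omega>) (\<theta> s \<omega>) + ereal s = perfect_lifetime x \<omega>"
    if "0 \<le> s" "ereal s < perfect_lifetime x \<omega>" for s x
    using perfect_cocycle[OF \<omega> that] by blast
  show "perfect_flow (t + s) x \<omega> = perfect_flow t (perfect_flow s x \<omega>) (\<theta> s \<omega>)"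
    if st: "0 \<le> s" "0 \<le> t" "ereal (t + s) < perfect_lifetime x \<omega>" for s t x
  proof -
    have "ereal s \<le> ereal (t + s)"
      using st by simp
    then have "ereal s < perfect_lifetime x \<omega>"
      using st(3) by (rule le_less_trans)
    from perfect_cocycle[OF \<omega> st(1) this] st show ?thesis
      by blast
  qed
qed (fact measurable_perfect_lifetime measurable_perfect_flow)+

lemma continuous_local_rds_perfect:
  assumes "continuous_local_semi_flow M \<phi> \<Theta>"
  shows "continuous_local_rds M \<theta> perfect_flow perfect_lifetime"
proof -
  interpret C: continuous_local_semi_flow M \<phi> \<Theta> by fact
  have "continuous_on {x. ereal t < perfect_lifetime x \<omega>} (\<lambda>x. perfect_flow t x \<omega>)"
    if \<omega>: "\<omega> \<in> space M" and "0 \<le> t" for \<omega> t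
  proof (cases "regular \<omega>")
    case True
    then show ?thesis
      using C.flow_continuous[of "\<theta> (- start \<omega>) \<omega>" "start \<omega>" "start \<omega> + t"] \<omega> \<open>0 \<le> t\<close> start(1)
      by (simp add: perfect_start_eqs(2,3)[OF \<omega> True])
  qed (simp add: not_regular)
  then show ?thesis
    using local_rds_perfect by (simp add: continuous_local_rds_def continuous_local_rds_axioms_def)
qed

lemma global_rds_perfect:
  assumes "global_semi_flow M \<phi> \<Theta>"
  shows "global_rds M \<theta> perfect_flow perfect_lifetime"
proof -
  interpret G: global_semi_flow M \<phi> \<Theta> by fact
  have "perfect_lifetime x \<omega> = \<infinity>" if "\<omega> \<in> space M" for \<omega> x
    using that G.flow_global start(1) by (simp add: perfect_lifetime_def)
  then show ?thesis
    using local_rds_perfect by (simp add: global_rds_def global_rds_axioms_def)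
qed

text \<open>If \<open>\<omega>\<close> itself is good, then \<open>r = 0\<close> is an admissible
  starting time, and independence of the choice identifies the perfect version with the flow started
  at \<open>0\<close>. The good regular event is a measurable subset of full measure, which bounds
  the inner measure from below.\<close>

lemma indistinguishable_perfect:
  "indistinguishable M (\<phi> 0) (\<Theta> 0) perfect_flow perfect_lifetime"
proof -
  let ?A = "{\<omega> \<in> space M. (\<forall>x. perfect_lifetime x \<omega> = \<Theta> 0 x \<omega>) \<and>
    (\<forall>x t. 0 \<le> t \<and> ereal t < perfect_lifetime x \<omega> \<longrightarrow> perfect_flow t x \<omega> = \<phi> 0 t x \<omega>)}"
  let ?G = "{\<omega> \<in> space M. \<omega> \<in> good_set \<and> regular \<omega>}"
  have G: "?G \<in> sets M"
    by measurable
  have "?G \<subseteq> ?A"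
  proof
    fix \<omega> assume "\<omega> \<in> ?G"
    then have \<omega>: "\<omega> \<in> space M" "regular \<omega>" "\<theta> (- 0) \<omega> \<in> good_set"
      by (simp_all add: shift_zero)
    have "perfect_lifetime x \<omega> = \<Theta> 0 x \<omega>" for x
      using perfect_lifetime_eq[OF \<omega>(1,2) order_refl \<omega>(3)] \<omega>(1)
      by (simp add: shift_zero zero_ereal_def[symmetric])
    moreover have "perfect_flow t x \<omega> = \<phi> 0 t x \<omega>"
      if "0 \<le> t" "ereal t < perfect_lifetime x \<omega>" for t x
      using perfect_flow_eq[OF \<omega>(1,2) order_refl \<omega>(3) that] \<omega>(1) by (simp add: shift_zero)
    ultimately show "\<omega> \<in> ?A"
      using \<omega>(1) by simp
  qed
  moreover have "AE \<omega> in M. \<omega> \<in> ?G"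
    using good_set(2) AE_regular AE_space by eventually_elim simp
  then have "emeasure M ?G = 1"
    using emeasure_eq_1_AE[OF G] by simp
  ultimately have "1 \<le> inner_measure M ?A"
    unfolding inner_measure_def using G by (intro SUP_upper2[of ?G]) auto
  moreover have "inner_measure M ?A \<le> 1"
    unfolding inner_measure_def by (intro SUP_least emeasure_le_1)
  ultimately show ?thesis
    unfolding indistinguishable_def by (rule antisym[rotated])
qed

end

theorem theorem2p7:
  fixes M :: "'w measure"
    and \<theta> :: "real \<Rightarrow> 'w \<Rightarrow> 'w"
    and \<phi> :: "real \<Rightarrow> real \<Rightarrow> 'a::polish_space \<Rightarrow> 'w \<Rightarrow> 'a"
    and \<Theta> :: "real \<Rightarrow> 'a \<Rightarrow> 'w \<Rightarrow> ereal"
  assumes "metric_dynamical_system M \<theta>"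
    and "local_semi_flow M \<phi> \<Theta>"
    and "\<And>s. 0 \<le> s \<Longrightarrow> \<exists>N \<in> null_sets M. \<forall>x. \<forall>\<omega> \<in> space M - N.
          \<Theta> s x \<omega> = \<Theta> 0 x (\<theta> s \<omega>) + ereal s \<and>
          (\<forall>t. 0 \<le> t \<and> ereal t < \<Theta> s x \<omega> - ereal s \<longrightarrow> \<phi> s (s + t) x \<omega> = \<phi> 0 t x (\<theta> s \<omega>))"
  shows "\<exists>(\<tau> :: 'a \<Rightarrow> 'w \<Rightarrow> ereal) (\<psi> :: real \<Rightarrow> 'a \<Rightarrow> 'w \<Rightarrow> 'a).
          indistinguishable M (\<phi> 0) (\<Theta> 0) \<psi> \<tau> \<and>
          local_rds M \<theta> \<psi> \<tau> \<and>
          (continuous_local_semi_flow M \<phi> \<Theta> \<longrightarrow> continuous_local_rds M \<theta> \<psi> \<tau>) \<and>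
          (global_semi_flow M \<phi> \<Theta> \<longrightarrow> global_rds M \<theta> \<psi> \<tau>)"
proof -
  interpret metric_dynamical_system M \<theta> by fact
  interpret local_semi_flow M \<phi> \<Theta> by fact
  interpret crude_cocycle M \<theta> \<phi> \<Theta>
    by unfold_locales (fact assms(3))
  show ?thesis
    using indistinguishable_perfect local_rds_perfect continuous_local_rds_perfect
      global_rds_perfect by blast
qed

end
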